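(* Let $r,L\ge 1$ be integers and $2s\in\mathbb{Z}_{\ge0}$. Let $I_1,\dots,I_k\subset\{1,\dots,r+1\}$ be pairwise disjoint subsets with $|I_i|=r_i+1\ge 2$, let $\Psi^+=\bigsqcup_{i=1}^k\Phi_i^+$ with $\Phi_i^+=\{L_a-L_b: a<b,\ a,b\in I_i\}$, and let $\mathfrak{h}=\mathfrak{h}(\Psi^+)\cong\mathfrak{gl}(1)^{\oplus n}\oplus A_{r_1}\oplus\dots\oplus A_{r_k}\subset A_r$, $n=r-\sum_ir_i$, be the corresponding maximal rank subalgebra. Let $\lambda=(\lambda_1,\dots,\lambda_{r+1})$ be a tuple of nonnegative integers with $\sum_i\lambda_i=2sL$ such that for each $i=1,\dots,k$ the subsequence $\lambda^{(i)}=(\lambda_a)_{a\in I_i}$ (indices in increasing order) is weakly decreasing, and let $\vec M=(M_1,\dots,M_r)$ be determined by $\lambda_j=M_{j-1}-M_j$ for $j=1,\dots,r+1$, with $M_0=2sL$, $M_{r+1}=0$. Then the multiplicity $\mu_\lambda^{\mathfrak{h}}$ of the irreducible representation $V_\lambda^{\mathfrak{h}}$ of $\mathfrak{h}$ in the restriction to $\mathfrak{h}$ of the $A_r$-representation $V_{(2s)}^{\otimes L}$ is $$\mu_\lambda^{\mathfrak{h}}=\mathcal{D}_{R_{\mathfrak{h}}(t)}\,c_{s,L}(\vec M).$$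
   Context: $A_r=\mathfrak{sl}(r+1)$ over $\mathbb{C}$, with standard weights $L_1,\dots,L_{r+1}$ ($\sum L_i=0$), simple roots $\alpha_i=L_i-L_{i+1}$, and positive roots $L_a-L_b$ ($a<b$). $\mathfrak{h}(\Psi^+)$ is the subalgebra spanned by the Cartan subalgebra of $A_r$ and the root spaces of the roots $\pm\alpha$, $\alpha\in\Psi^+$. $V_{(2s)}\cong\mathrm{Sym}^{2s}(\mathbb{C}^{r+1})$, with character $\chi_{(2s)}(x)$ the complete homogeneous symmetric polynomial of degree $2s$ in $x_1,\dots,x_{r+1}$, where $x_i=e^{L_i}$. Let $\hat I=\{1,\dots,r+1\}\setminus\bigcup_jI_j$. For $\lambda$ as in the claim, $V_\lambda^{\mathfrak{h}}$ is the irreducible representation of $\mathfrak{h}$ with highest weight $\sum_i\lambda_iL_i$; its character is $\chi_\lambda(\mathfrak{h})=\prod_{m\in\hat I}x_m^{\lambda_m}\prod_{i=1}^k\chi_{\lambda^{(i)}}\big((x_a)_{a\in I_i}\big)$, where $\chi_{\lambda^{(i)}}$ is the Schur polynomial in the $r_i+1$ variables indexed by $I_i$. The multiplicities are determined by $[\chi_{(2s)}(x)]^L=\sum_\lambda\mu_\lambda^{\mathfrak{h}}\chi_\lambda(\mathfrak{h})$, the sum being over all $\lambda$ as in the claim. The integers $c_{s,L}(\vec M)$ are defined by $$[\chi_{(2s)}(x)]^L=\sum_{0\le M_r\le\dots\le M_1\le 2sL}c_{s,L}(\vec M)\,x_1^{2sL-M_1}x_2^{M_1-M_2}\cdots x_r^{M_{r-1}-M_r}x_{r+1}^{M_r},$$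 and $c_{s,L}(\vec M)=0$ for $\vec M\in\mathbb{Z}^r$ outside the range of summation. Shift operator: for a polynomial $P(t_1,\dots,t_r)=\sum_\beta p_\beta t_1^{\beta_1}\cdots t_r^{\beta_r}$ and a function $f$ on $\mathbb{Z}^r$, $\mathcal{D}_{P}f(M_1,\dots,M_r)=\sum_\beta p_\beta f(M_1-\beta_1,\dots,M_r-\beta_r)$. Weyl denominator of $\mathfrak{h}$ (the product of the Weyl denominators of its simple factors): $R_{\mathfrak{h}}(t)=\prod_{\alpha\in\Psi^+}(1-t^\alpha)$, where $t^\alpha=t_1^{n_1}\cdots t_r^{n_r}$ if $\alpha=\sum_in_i\alpha_i$ in the simple roots of $A_r$; i.e. $t^{L_a-L_b}=t_at_{a+1}\cdots t_{b-1}$. *)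

theory Defs
  imports "HOL-Library.Poly_Mapping" "HOL-Library.FuncSet" "HOL-Library.Disjoint_Sets"
begin

text \<open>
  Monomials are finitely supported exponent vectors, and \<open>lookup p m\<close> is the coefficient of the
  monomial \<open>m\<close> in the polynomial \<open>p\<close>. The same ring is used for the variables \<open>x\<^sub>i = e\<^bsup>L\<^sub>i\<^esup>\<close>
  and for the shift variables \<open>t\<^sub>i\<close>.
\<close>

type_synonym monomial = "nat \<Rightarrow>\<^sub>0 nat"
type_synonym mpoly = "monomial \<Rightarrow>\<^sub>0 int"

definition var :: "nat \<Rightarrow> mpoly" where
  "var i = Poly_Mapping.single (Poly_Mapping.single i 1) 1"


section \<open>Characters\<close>

text \<open>
  Throughout, \<open>d\<close> stands for the nonnegative integer \<open>2s\<close>. The character of \<open>V\<^bsub>(d)\<^esub> = Sym\<^sup>d(\<complex>\<^bsup>r+1\<^esup>)\<close>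
  is the complete homogeneous symmetric polynomial.
\<close>

definition complete_homogeneous :: "nat set \<Rightarrow> nat \<Rightarrow> mpoly" where
  "complete_homogeneous J d =
     (\<Sum>m\<in>{m. Poly_Mapping.keys m \<subseteq> J \<and> (\<Sum>i\<in>J. Poly_Mapping.lookup m i) = d}. Poly_Mapping.single m 1)"

definition sym_char :: "nat \<Rightarrow> nat \<Rightarrow> mpoly" where
  "sym_char r d = complete_homogeneous {1..r+1} d"

text \<open>
  Semistandard Young tableaux of shape \<open>(lam\<^sub>a)\<^bsub>a\<in>J\<^esub>\<close> with entries in \<open>J\<close>. The rows are labelled by the
  elements of \<open>J\<close> in increasing order (rather than by \<open>1, \<dots>, |J|\<close>), and the boxes of row \<open>a\<close> are
  \<open>(a, q)\<close> with \<open>q < lam\<^sub>a\<close>. This is meant for \<open>lam\<close> weakly decreasing on \<open>J\<close>.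
\<close>

definition boxes :: "nat set \<Rightarrow> (nat \<Rightarrow>\<^sub>0 nat) \<Rightarrow> (nat \<times> nat) set" where
  "boxes J lam = (SIGMA a:J. {..<Poly_Mapping.lookup lam a})"

definition ssyt :: "nat set \<Rightarrow> (nat \<Rightarrow>\<^sub>0 nat) \<Rightarrow> (nat \<times> nat \<Rightarrow> nat) set" where
  "ssyt J lam = {T \<in> boxes J lam \<rightarrow>\<^sub>E J.
     (\<forall>a p q. (a, p) \<in> boxes J lam \<and> (a, q) \<in> boxes J lam \<and> p < q \<longrightarrow> T (a, p) \<le> T (a, q)) \<and>
     (\<forall>a b q. (a, q) \<in> boxes J lam \<and> (b, q) \<in> boxes J lam \<and> a < b \<longrightarrow> T (a, q) < T (b, q))}"

definition schur :: "nat set \<Rightarrow> (nat \<Rightarrow>\<^sub>0 nat) \<Rightarrow> mpoly" where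
  "schur J lam = (\<Sum>T\<in>ssyt J lam. \<Prod>c\<in>boxes J lam. var (T c))"


section \<open>The subalgebra and the multiplicities\<close>

text \<open>
  The subalgebra \<open>\<hh>\<close> is given by the blocks \<open>I 1, \<dots>, I k\<close>. A highest weight
  \<open>\<Sum>\<^sub>i lam\<^sub>i L\<^sub>i\<close> is given by the tuple \<open>lam\<close>, extended by \<open>0\<close> outside \<open>{1..r+1}\<close>.
\<close>

definition highest_weights :: "nat \<Rightarrow> nat \<Rightarrow> nat \<Rightarrow> nat \<Rightarrow> (nat \<Rightarrow> nat set) \<Rightarrow> (nat \<Rightarrow>\<^sub>0 nat) set" where
  "highest_weights r d L k I = {lam.
     Poly_Mapping.keys lam \<subseteq> {1..r+1} \<and> (\<Sum>i=1..r+1. Poly_Mapping.lookup lam i) = d * L \<and>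
     (\<forall>i\<in>{1..k}. \<forall>a\<in>I i. \<forall>b\<in>I i. a < b \<longrightarrow> Poly_Mapping.lookup lam b \<le> Poly_Mapping.lookup lam a)}"

definition irrep_char :: "nat \<Rightarrow> nat \<Rightarrow> (nat \<Rightarrow> nat set) \<Rightarrow> (nat \<Rightarrow>\<^sub>0 nat) \<Rightarrow> mpoly" where
  "irrep_char r k I lam =
     (\<Prod>m\<in>{1..r+1} - (\<Union>i\<in>{1..k}. I i). var m ^ Poly_Mapping.lookup lam m) * (\<Prod>i=1..k. schur (I i) lam)"

text \<open>
  The multiplicities of the irreducible \<open>\<hh>\<close>-representations in \<open>V\<^bsub>(d)\<^esub>\<^bsup>\<otimes>L\<^esup>\<close> are the coefficients
  in the expansion of its character in the irreducible characters of \<open>\<hh>\<close>. The condition outside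
  \<open>highest_weights\<close> only makes the family unique as a total function.
\<close>

definition multiplicity_h ::
  "nat \<Rightarrow> nat \<Rightarrow> nat \<Rightarrow> nat \<Rightarrow> (nat \<Rightarrow> nat set) \<Rightarrow> (nat \<Rightarrow>\<^sub>0 nat) \<Rightarrow> int" where
  "multiplicity_h r d L k I = (THE mu.
     (\<forall>lam. lam \<notin> highest_weights r d L k I \<longrightarrow> mu lam = 0) \<and>
     sym_char r d ^ L = (\<Sum>lam\<in>highest_weights r d L k I. of_int (mu lam) * irrep_char r k I lam))"


section \<open>The coefficients \<open>c\<^bsub>s,L\<^esub>\<close> and the shift operator\<close>

text \<open>
  A vector in \<open>\<int>\<^sup>r\<close> is a function \<open>M\<close> of which only \<open>M 1, \<dots>, M r\<close> matter; \<open>pad\<close> supplies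
  \<open>M\<^sub>0 = N\<close> and \<open>M\<^bsub>r+1\<^esub> = 0\<close>.
\<close>

definition pad :: "nat \<Rightarrow> nat \<Rightarrow> (nat \<Rightarrow> int) \<Rightarrow> nat \<Rightarrow> int" where
  "pad r N M j = (if j = 0 then int N else if j \<le> r then M j else 0)"

definition coeff_c :: "nat \<Rightarrow> nat \<Rightarrow> nat \<Rightarrow> (nat \<Rightarrow> int) \<Rightarrow> int" where
  "coeff_c r d L M =
     (if \<forall>j\<in>{1..r+1}. pad r (d * L) M j \<le> pad r (d * L) M (j - 1)
      then Poly_Mapping.lookup (sym_char r d ^ L)
        (\<Sum>j=1..r+1. Poly_Mapping.single j (nat (pad r (d * L) M (j - 1) - pad r (d * L) M j)))
      else 0)"

definition shift_op :: "mpoly \<Rightarrow> ((nat \<Rightarrow> int) \<Rightarrow> int) \<Rightarrow> (nat \<Rightarrow> int) \<Rightarrow> int" where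
  "shift_op P f M = (\<Sum>\<beta>\<in>Poly_Mapping.keys P. Poly_Mapping.lookup P \<beta> * f (\<lambda>i. M i - int (Poly_Mapping.lookup \<beta> i)))"

text \<open>The root \<open>L\<^sub>a - L\<^sub>b = \<alpha>\<^sub>a + \<dots> + \<alpha>\<^bsub>b-1\<^esub>\<close> (for \<open>a < b\<close>) is encoded as the pair \<open>(a, b)\<close>.\<close>

definition positive_roots :: "nat \<Rightarrow> (nat \<Rightarrow> nat set) \<Rightarrow> (nat \<times> nat) set" where
  "positive_roots k I = (\<Union>i\<in>{1..k}. {(a, b). a \<in> I i \<and> b \<in> I i \<and> a < b})"

definition weyl_denominator :: "(nat \<times> nat) set \<Rightarrow> mpoly" where
  "weyl_denominator Psi = (\<Prod>(a, b)\<in>Psi. 1 - (\<Prod>i\<in>{a..<b}. var i))"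

end

theory Submission
  imports Defs "Jordan_Normal_Form.Determinant" "HOL-Library.Infinite_Set"
begin

text \<open>
  Write \<open>\<Delta>\<close> for the product of \<open>x\<^sub>a - x\<^sub>b\<close> and \<open>\<rho>\<close> for the sum of the \<open>L\<^sub>a\<close>, both over the positive roots
  \<open>L\<^sub>a - L\<^sub>b\<close> of \<open>\<hh>\<close>. By the bialternant formula, \<open>\<Delta>\<close> times the irreducible character of highest weight
  \<open>\<lambda>\<close> is a signed sum of monomials in which \<open>x\<^bsup>\<lambda>+\<rho>\<^esup>\<close> is the only strictly dominant one. Hence the
  multiplicity of \<open>\<lambda>\<close> in any expansion of a character \<open>\<chi>\<close> is the coefficient of \<open>x\<^bsup>\<lambda>+\<rho>\<^esup>\<close> in \<open>\<Delta> \<chi>\<close>. Conversely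
  these coefficients do give an expansion of \<open>\<chi> = [\<chi>\<^bsub>(2s)\<^esub>]\<^sup>L\<close>: the difference, multiplied by \<open>\<Delta>\<close>, is antisymmetric
  without strictly dominant monomials, so it vanishes. Finally, \<open>\<Delta>\<close> is \<open>x\<^sup>\<rho>\<close> times the product of \<open>1 - x\<^sub>b / x\<^sub>a\<close>, and
  multiplication by \<open>x\<^sub>b / x\<^sub>a\<close> is the shift of the coefficients by \<open>t\<^bsup>L\<^sub>a - L\<^sub>b\<^esup>\<close>.

  The bialternant formula is proved by induction on the number of variables: column operations turn the
  alternant into a sum of smaller alternants over interlacing exponents, which matches the branching rule
  for semistandard tableaux.
\<close>

section \<open>Bialternants and semistandard tableaux\<close>

definition alternant :: "nat \<Rightarrow> (nat \<Rightarrow> nat) \<Rightarrow> (nat \<Rightarrow> 'a::comm_ring_1) \<Rightarrow> 'a" where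
  "alternant m v x = det (mat m m (\<lambda>(i, j). x i ^ v j))"

lemma alternant_cong:
  assumes "\<And>j. j < m \<Longrightarrow> v j = w j" "\<And>i. i < m \<Longrightarrow> x i = y i"
  shows "alternant m v x = alternant m w y"
  unfolding alternant_def by (intro arg_cong[where f = det] eq_matI) (auto simp: assms)

text \<open>A telescoping geometric sum in homogeneous form. In \<open>alternant_Suc\<close> it
  extracts the common factor \<open>x i - x m\<close> from the entries produced by the column
  operations.\<close>

lemma power_diff_homogeneous:
  fixes x y :: "'a::comm_ring_1"
  assumes "b \<le> a"
  shows "x ^ a - x ^ b * y ^ (a - b) = (x - y) * (\<Sum>k\<in>{b..<a}. x ^ k * y ^ (a - 1 - k))"
  using assms
proof (induction a rule: dec_induct)
  case base
  then show ?case by simp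
next
  case (step n)
  have "x ^ Suc n - x ^ b * y ^ (Suc n - b) = (x - y) * x ^ n + y * (x ^ n - x ^ b * y ^ (n - b))"
    using step.hyps by (simp add: Suc_diff_le algebra_simps)
  also have "y * (x ^ n - x ^ b * y ^ (n - b)) = (x - y) * (\<Sum>k\<in>{b..<n}. x ^ k * (y * y ^ (n - 1 - k)))"
    by (simp add: step.IH sum_distrib_left mult_ac)
  also have "(\<Sum>k\<in>{b..<n}. x ^ k * (y * y ^ (n - 1 - k))) = (\<Sum>k\<in>{b..<n}. x ^ k * y ^ (n - k))"
  proof (rule sum.cong)
    fix k assume "k \<in> {b..<n}"
    then have "n - k = Suc (n - 1 - k)" by auto
    then show "x ^ k * (y * y ^ (n - 1 - k)) = x ^ k * y ^ (n - k)" by simp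
  qed simp
  finally show ?case using step.hyps by (simp add: algebra_simps)
qed

text \<open>Subtracting from each column a multiple of the next one, with a power of
  \<open>x m\<close> as factor, clears the last row except for its last entry and makes every other
  entry of row \<open>i\<close> divisible by \<open>x i - x m\<close>. The quotients are sums over
  an exponent in \<open>{v (Suc j)..<v j}\<close>, so multilinearity in the columns yields smaller
  alternants over interlacing exponents.\<close>

lemma alternant_Suc:
  fixes x :: "nat \<Rightarrow> 'a::comm_ring_1"
  assumes v: "\<And>j. j < m \<Longrightarrow> v (Suc j) \<le> v j"
  shows "alternant (Suc m) v x =
    (\<Prod>i<m. x i - x m) * (\<Sum>w\<in>(\<Pi>\<^sub>E j\<in>{..<m}. {v (Suc j)..<v j}).
      alternant m w x * x m ^ (v m + (\<Sum>j<m. v j - 1 - w j)))"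
proof -
  define A where "A = mat (Suc m) (Suc m) (\<lambda>(i, j). x i ^ v j)"
  \<comment> \<open>Right multiplication by this unitriangular matrix carries out all column
    operations at once, each with the original next column.\<close>
  define U where "U = mat (Suc m) (Suc m) (\<lambda>(i, j). if i = j then 1 else
    if i = Suc j then - (x m ^ (v j - v (Suc j))) else 0)"
  define g where "g i j = (\<Sum>k\<in>{v (Suc j)..<v j}. x i ^ k * x m ^ (v j - 1 - k))" for i j
  have A[simp]: "A \<in> carrier_mat (Suc m) (Suc m)" and U[simp]: "U \<in> carrier_mat (Suc m) (Suc m)"
    by (auto simp: A_def U_def)
  have "det U = prod_list (diag_mat U)"
    by (rule det_lower_triangular[OF _ U]) (auto simp: U_def)
  also have "diag_mat U = map (\<lambda>_. 1) [0..<Suc m]"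
    unfolding diag_mat_def by (rule map_cong) (auto simp: U_def)
  finally have detU: "det U = 1" by (simp add: map_replicate_const del: upt_Suc)
  have AU: "(A * U) $$ (i, j) = (if j = m then x i ^ v m else (x i - x m) * g i j)"
    if "i \<le> m" "j \<le> m" for i j
  proof -
    have "(A * U) $$ (i, j) = (\<Sum>k = 0..<Suc m. x i ^ v k * U $$ (k, j))"
      using that A U by (simp add: A_def scalar_prod_def U_def del: sum.op_ivl_Suc)
    also have "\<dots> = (\<Sum>k = 0..<Suc m. (if k = j then x i ^ v j else 0) +
        (if k = Suc j then - (x i ^ v (Suc j) * x m ^ (v j - v (Suc j))) else 0))"
      by (rule sum.cong) (use that in \<open>auto simp: U_def\<close>)
    also have "\<dots> = x i ^ v j - (if j < m then x i ^ v (Suc j) * x m ^ (v j - v (Suc j)) else 0)"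
      using that by (simp add: sum.distrib del: sum.op_ivl_Suc)
    finally show ?thesis
      using that by (auto simp: g_def power_diff_homogeneous[OF v])
  qed
  define B where "B = mat m m (\<lambda>(i, j). (x i - x m) * g i j)"
  have del: "mat_delete (A * U) m m = B"
  proof (rule eq_matI)
    fix i j assume "i < dim_row B" "j < dim_col B"
    then have "i < m" "j < m" by (auto simp: B_def)
    then show "mat_delete (A * U) m m $$ (i, j) = B $$ (i, j)"
      using AU[of i j] A U by (simp add: mat_delete_def B_def A_def U_def)
  qed (auto simp: mat_delete_def B_def A_def U_def)
  have "alternant (Suc m) v x = det (A * U)"
    using det_mult[OF A U] detU by (simp add: alternant_def A_def)
  also have "\<dots> = (\<Sum>j<Suc m. (A * U) $$ (m, j) * cofactor (A * U) m j)"
    by (rule laplace_expansion_row[OF mult_carrier_mat[OF A U]]) simp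
  \<comment> \<open>In row \<open>m\<close> the factor \<open>x i - x m\<close> vanishes, so only
    the last entry of the last row survives in the expansion.\<close>
  also have "\<dots> = x m ^ v m * det B"
    by (simp add: AU cofactor_def del)
  \<comment> \<open>The permutation is placed on the row index, so that the range of the exponent in
    the factor \<open>g (p j) j\<close> depends on the column \<open>j\<close> only and the choices
    \<open>w\<close> are independent of \<open>p\<close>.\<close>
  also have "det B = (\<Sum>p | p permutes {0..<m}. signof p * (\<Prod>j<m. B $$ (p j, j)))"
    by (rule det_col) (simp add: B_def)
  also have "\<dots> = (\<Sum>p | p permutes {0..<m}. \<Sum>w\<in>(\<Pi>\<^sub>E j\<in>{..<m}. {v (Suc j)..<v j}).
      (\<Prod>i<m. x i - x m) * (signof p * (\<Prod>j<m. x (p j) ^ w j) * x m ^ (\<Sum>j<m. v j - 1 - w j)))"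
  proof (rule sum.cong)
    fix p assume "p \<in> {p. p permutes {0..<m}}"
    then have p: "p permutes {..<m}" by (simp add: atLeast0LessThan)
    have pm: "p j < m" if "j < m" for j using permutes_in_image[OF p] that by auto
    have "(\<Prod>j<m. B $$ (p j, j)) = (\<Prod>j<m. (x (p j) - x m) * g (p j) j)"
      by (intro prod.cong) (auto simp: B_def pm)
    also have "\<dots> = (\<Prod>j<m. x (p j) - x m) * (\<Prod>j<m. g (p j) j)"
      by (simp add: prod.distrib)
    also have "(\<Prod>j<m. x (p j) - x m) = (\<Prod>j<m. x j - x m)"
      using prod.permute[OF p, of "\<lambda>i. x i - x m"] by (simp add: o_def)
    also have "(\<Prod>j<m. g (p j) j) = (\<Sum>w\<in>(\<Pi>\<^sub>E j\<in>{..<m}. {v (Suc j)..<v j}).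
        \<Prod>j<m. x (p j) ^ w j * x m ^ (v j - 1 - w j))"
      unfolding g_def by (subst prod_sum_PiE) auto
    finally show "signof p * (\<Prod>j<m. B $$ (p j, j)) =
      (\<Sum>w\<in>(\<Pi>\<^sub>E j\<in>{..<m}. {v (Suc j)..<v j}).
      (\<Prod>i<m. x i - x m) * (signof p * (\<Prod>j<m. x (p j) ^ w j) * x m ^ (\<Sum>j<m. v j - 1 - w j)))"
      by (simp add: sum_distrib_left prod.distrib power_sum mult_ac)
  qed simp
  also have "\<dots> = (\<Sum>w\<in>(\<Pi>\<^sub>E j\<in>{..<m}. {v (Suc j)..<v j}).
      (\<Prod>i<m. x i - x m) * (alternant m w x * x m ^ (\<Sum>j<m. v j - 1 - w j)))"
  proof (subst sum.swap, rule sum.cong)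
    fix w
    have "alternant m w x = (\<Sum>p | p permutes {0..<m}. signof p *
        (\<Prod>j<m. mat m m (\<lambda>(i, j). x i ^ w j) $$ (p j, j)))"
      unfolding alternant_def by (rule det_col) simp
    also have "\<dots> = (\<Sum>p | p permutes {0..<m}. signof p * (\<Prod>j<m. x (p j) ^ w j))"
    proof (rule sum.cong)
      fix p assume "p \<in> {p. p permutes {0..<m}}"
      then have "p j < m" if "j < m" for j using permutes_in_image[of p "{0..<m}"] that by auto
      then show "signof p * (\<Prod>j<m. mat m m (\<lambda>(i, j). x i ^ w j) $$ (p j, j)) =
          signof p * (\<Prod>j<m. x (p j) ^ w j)"
        by (auto simp: atLeast0LessThan intro!: arg_cong[where f = "\<lambda>t. signof p * t"] prod.cong)
    qed simp
    finally show "(\<Sum>p | p permutes {0..<m}. (\<Prod>i<m. x i - x m) *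
        (signof p * (\<Prod>j<m. x (p j) ^ w j) * x m ^ (\<Sum>j<m. v j - 1 - w j))) =
      (\<Prod>i<m. x i - x m) * (alternant m w x * x m ^ (\<Sum>j<m. v j - 1 - w j))"
      by (simp add: sum_distrib_left sum_distrib_right mult_ac)
  qed simp
  finally show ?thesis
    by (simp add: sum_distrib_left power_add mult_ac)
qed

section \<open>Tableaux with entries in an initial segment, and their branching rule\<close>

definition cells :: "nat \<Rightarrow> (nat \<Rightarrow> nat) \<Rightarrow> (nat \<times> nat) set" where
  "cells m f = (SIGMA i:{..<m}. {..<f i})"

text \<open>The normal form of \<open>ssyt\<close> in which rows and entries are both numbered from
  \<open>0\<close>, suited to induction on \<open>m\<close>; \<open>schur_eq_tableau_sum\<close>
  translates back.\<close>

definition tableaux :: "nat \<Rightarrow> (nat \<Rightarrow> nat) \<Rightarrow> (nat \<times> nat \<Rightarrow> nat) set" where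
  "tableaux m f = {T \<in> cells m f \<rightarrow>\<^sub>E {..<m}.
     (\<forall>i p q. (i, p) \<in> cells m f \<and> (i, q) \<in> cells m f \<and> p < q \<longrightarrow> T (i, p) \<le> T (i, q)) \<and>
     (\<forall>i j q. (i, q) \<in> cells m f \<and> (j, q) \<in> cells m f \<and> i < j \<longrightarrow> T (i, q) < T (j, q))}"

definition tableau_sum :: "nat \<Rightarrow> (nat \<Rightarrow> nat) \<Rightarrow> (nat \<Rightarrow> 'a::comm_ring_1) \<Rightarrow> 'a" where
  "tableau_sum m f x = (\<Sum>T\<in>tableaux m f. \<Prod>c\<in>cells m f. x (T c))"

lemma mem_cells [simp]: "(i, q) \<in> cells m f \<longleftrightarrow> i < m \<and> q < f i"
  by (auto simp: cells_def)

lemma finite_cells [simp]: "finite (cells m f)"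
  by (auto simp: cells_def)

lemma finite_tableaux [simp]: "finite (tableaux m f)"
  by (rule finite_subset[of _ "cells m f \<rightarrow>\<^sub>E {..<m}"]) (auto simp: tableaux_def finite_PiE)

lemma tableauxI:
  assumes "T \<in> extensional (cells m f)"
    and "\<And>i q. i < m \<Longrightarrow> q < f i \<Longrightarrow> T (i, q) < m"
    and "\<And>i p q. i < m \<Longrightarrow> p < q \<Longrightarrow> q < f i \<Longrightarrow> T (i, p) \<le> T (i, q)"
    and "\<And>i j q. i < j \<Longrightarrow> j < m \<Longrightarrow> q < f i \<Longrightarrow> q < f j \<Longrightarrow> T (i, q) < T (j, q)"
  shows "T \<in> tableaux m f"
  using assms by (auto simp: tableaux_def PiE_def)

lemma tableauxD:
  assumes "T \<in> tableaux m f"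
  shows "T \<in> extensional (cells m f)"
    and "\<And>i q. i < m \<Longrightarrow> q < f i \<Longrightarrow> T (i, q) < m"
    and "\<And>i p q. i < m \<Longrightarrow> p < q \<Longrightarrow> q < f i \<Longrightarrow> T (i, p) \<le> T (i, q)"
    and "\<And>i j q. i < j \<Longrightarrow> j < m \<Longrightarrow> q < f i \<Longrightarrow> q < f j \<Longrightarrow> T (i, q) < T (j, q)"
  using assms unfolding tableaux_def PiE_def by (auto simp: Pi_iff)

text \<open>In a partition shape the column above a cell has no gaps, and its entries increase
  strictly from row to row. For a tableau with \<open>Suc m\<close> rows and entries below
  \<open>Suc m\<close>, the case \<open>i = m\<close> forces the whole last row to be
  \<open>m\<close>.\<close>

lemma tableau_row_le:
  assumes T: "T \<in> tableaux m f" and f: "\<And>i j. i < j \<Longrightarrow> j < m \<Longrightarrow> f j \<le> f i"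
    and "i < m" "q < f i"
  shows "i \<le> T (i, q)"
  using assms(3,4)
proof (induction i)
  case (Suc i)
  have "q < f i" using f[of i "Suc i"] Suc.prems by simp
  then show ?case
    using Suc.IH Suc.prems tableauxD(4)[OF T, of i "Suc i" q] by simp
qed simp

text \<open>The entries \<open>m\<close> of a tableau with entries in \<open>{..m}\<close> form a horizontal strip, and they fill the last row.\<close>

lemma tableau_sum_Suc:
  fixes x :: "nat \<Rightarrow> 'a::comm_ring_1"
  assumes f: "\<And>i j. i < j \<Longrightarrow> j < Suc m \<Longrightarrow> f j \<le> f i"
  shows "tableau_sum (Suc m) f x = (\<Sum>g\<in>(\<Pi>\<^sub>E j\<in>{..<m}. {f (Suc j)..f j}).
    tableau_sum m g x * x m ^ (f m + (\<Sum>j<m. f j - g j)))"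
proof -
  define G where "G = (\<Pi>\<^sub>E j\<in>{..<m}. {f (Suc j)..f j})"
  \<comment> \<open>The number of entries below \<open>m\<close> in row \<open>i\<close>. The
    alternative \<open>f i \<le> q\<close> guarantees that the minimum exists and gives the full
    length \<open>f i\<close> when no \<open>m\<close> occurs in the row.\<close>
  define sh where "sh T = (\<lambda>i\<in>{..<m}. LEAST q. f i \<le> q \<or> T (i, q) = m)" for T :: "nat \<times> nat \<Rightarrow> nat"
  \<comment> \<open>\<open>fw\<close> erases the entries \<open>m\<close> and records the remaining
    shape; \<open>bw\<close> fills the erased cells with \<open>m\<close> again.\<close>
  define fw where "fw T = (sh T, restrict T (cells m (sh T)))" for T :: "nat \<times> nat \<Rightarrow> nat"
  define bw where "bw = (\<lambda>(g, T). (\<lambda>c\<in>cells (Suc m) f. if c \<in> cells m g then T c else m :: nat))"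
  have G: "g i \<le> f i" "f (Suc i) \<le> g i" if "g \<in> G" "i < m" for g i
    using that by (auto simp: G_def PiE_def Pi_iff)
  have sh_le: "sh T i \<le> f i" if "i < m" for T i
    using that by (auto simp: sh_def intro: Least_le)
  have sh: "T (i, q) < m \<longleftrightarrow> q < sh T i" if T: "T \<in> tableaux (Suc m) f" and i: "i < m" and q: "q < f i" for T i q
  proof -
    have lt: "T (i, q) < Suc m" using tableauxD(2)[OF T] i q by simp
    let ?P = "\<lambda>q. f i \<le> q \<or> T (i, q) = m"
    have e: "sh T i = (LEAST q. ?P q)" using i by (simp add: sh_def)
    show ?thesis
    proof
      assume *: "T (i, q) < m"
      show "q < sh T i"
      proof (rule ccontr)
        assume "\<not> q < sh T i"
        then have le: "sh T i \<le> q" by simp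
        have "?P (sh T i)" unfolding e by (rule LeastI[of ?P "f i"]) simp
        then have "T (i, sh T i) = m" using le q by simp
        moreover have "T (i, sh T i) \<le> T (i, q)"
          using tableauxD(3)[OF T, of i "sh T i" q] le i q by (cases "sh T i = q") auto
        ultimately show False using * by simp
      qed
    next
      assume "q < sh T i"
      then have "\<not> ?P q" unfolding e by (rule not_less_Least)
      then show "T (i, q) < m" using lt by simp
    qed
  qed
  have shG: "sh T \<in> G" if T: "T \<in> tableaux (Suc m) f" for T
    unfolding G_def
  proof (rule PiE_I)
    fix i assume "i \<in> {..<m}"
    then have i: "i < m" by simp
    \<comment> \<open>Below an entry \<open>m\<close> there would have to be a larger one, so row
      \<open>Suc i\<close> cannot reach past the entries below \<open>m\<close> of row
      \<open>i\<close>.\<close>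
    have "f (Suc i) \<le> sh T i"
    proof (rule ccontr)
      assume "\<not> f (Suc i) \<le> sh T i"
      then have *: "sh T i < f (Suc i)" by simp
      then have "sh T i < f i" using f[of i "Suc i"] i by simp
      then have "T (i, sh T i) < T (Suc i, sh T i)" "\<not> T (i, sh T i) < m" "T (Suc i, sh T i) < Suc m"
        using tableauxD(4)[OF T, of i "Suc i" "sh T i"] sh[OF T i] tableauxD(2)[OF T] i * by auto
      then show False by simp
    qed
    then show "sh T i \<in> {f (Suc i)..f i}" using sh_le[OF i] by simp
  qed (simp add: sh_def)
  have sub: "cells m g \<subseteq> cells (Suc m) f" if "g \<in> G" for g
    using G[OF that] by (fastforce simp: cells_def)
  have eqm: "T (i, q) = m" if T: "T \<in> tableaux (Suc m) f" and "(i, q) \<in> cells (Suc m) f" "(i, q) \<notin> cells m (sh T)" for T i q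
  proof (cases "i = m")
    case True
    then show ?thesis
      using tableau_row_le[OF T f, of m q] tableauxD(2)[OF T, of m q] that by simp
  next
    case False
    then show ?thesis
      using sh[OF T, of i q] tableauxD(2)[OF T, of i q] that by simp
  qed
  have bwT: "bw (g, T) \<in> tableaux (Suc m) f" if g: "g \<in> G" and T: "T \<in> tableaux m g" for g T
  proof (rule tableauxI)
    show "bw (g, T) \<in> extensional (cells (Suc m) f)" by (simp add: bw_def)
  next
    fix i q assume "i < Suc m" "q < f i"
    then show "bw (g, T) (i, q) < Suc m"
      using tableauxD(2)[OF T, of i q] by (auto simp: bw_def less_Suc_eq)
  next
    fix i p q assume "i < Suc m" "p < q" "q < f i"
    then show "bw (g, T) (i, p) \<le> bw (g, T) (i, q)"
      using tableauxD(2)[OF T, of i p] tableauxD(3)[OF T, of i p q] by (auto simp: bw_def less_Suc_eq)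
  next
    fix i j q assume a: "i < j" "j < Suc m" "q < f i" "q < f j"
    \<comment> \<open>A cell with another one below it lies in the smaller shape, by interlacing.
      Hence the upper entry comes from \<open>T\<close> and is less than \<open>m\<close>, while the
      lower one is either from \<open>T\<close> or equal to \<open>m\<close>.\<close>
    have "f j \<le> f (Suc i)" using f[of "Suc i" j] a by (cases "j = Suc i") auto
    then have "q < g i" using G(2)[OF g, of i] a by simp
    then show "bw (g, T) (i, q) < bw (g, T) (j, q)"
      using a tableauxD(2)[OF T, of i q] tableauxD(4)[OF T, of i j q] by (simp add: bw_def)
  qed
  have sh_bw: "sh (bw (g, T)) = g" if g: "g \<in> G" and T: "T \<in> tableaux m g" for g T
  proof
    fix i
    show "sh (bw (g, T)) i = g i"
    proof (cases "i < m")
      case True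
      have "q < sh (bw (g, T)) i \<longleftrightarrow> q < g i" if "q < f i" for q
        using sh[OF bwT[OF g T] True that] tableauxD(2)[OF T True, of q] True that
        by (auto simp: bw_def split: if_splits)
      then show ?thesis
        using sh_le[OF True, of "bw (g, T)"] G(1)[OF g True]
        by (metis linorder_less_linear order_less_irrefl order_less_le_trans)
    next
      case False
      then show ?thesis using g by (auto simp: sh_def G_def PiE_def extensional_def)
    qed
  qed
  have "tableau_sum (Suc m) f x = (\<Sum>(g, T)\<in>Sigma G (tableaux m).
      (\<Prod>c\<in>cells m g. x (T c)) * x m ^ (f m + (\<Sum>j<m. f j - g j)))"
    unfolding tableau_sum_def
  proof (rule sum.reindex_bij_witness[where i = bw and j = fw])
    fix T assume T: "T \<in> tableaux (Suc m) f"
    show "bw (fw T) = T"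
    proof
      fix c :: "nat \<times> nat"
      obtain i q where c: "c = (i, q)" by (cases c)
      show "bw (fw T) c = T c"
        using eqm[OF T, of i q] tableauxD(1)[OF T]
        by (auto simp: c bw_def fw_def extensional_def simp del: mem_cells)
    qed
    show "fw T \<in> Sigma G (tableaux m)"
    proof -
      have "restrict T (cells m (sh T)) \<in> tableaux m (sh T)"
      proof (rule tableauxI)
        fix i q assume "i < m" "q < sh T i"
        then show "restrict T (cells m (sh T)) (i, q) < m"
          using sh[OF T, of i q] sh_le[of i T] by simp
      next
        fix i p q assume "i < m" "p < q" "q < sh T i"
        then show "restrict T (cells m (sh T)) (i, p) \<le> restrict T (cells m (sh T)) (i, q)"
          using tableauxD(3)[OF T, of i p q] sh_le[of i T] by simp
      next
        fix i j q assume "i < j" "j < m" "q < sh T i" "q < sh T j"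
        then show "restrict T (cells m (sh T)) (i, q) < restrict T (cells m (sh T)) (j, q)"
          using tableauxD(4)[OF T, of i j q] sh_le[of i T] sh_le[of j T] by simp
      qed simp
      then show ?thesis using shG[OF T] by (simp add: fw_def)
    qed
    have sub': "cells m (sh T) \<subseteq> cells (Suc m) f" by (rule sub[OF shG[OF T]])
    have "(\<Prod>c\<in>cells (Suc m) f. x (T c)) =
        (\<Prod>c\<in>cells (Suc m) f - cells m (sh T). x (T c)) * (\<Prod>c\<in>cells m (sh T). x (T c))"
      by (rule prod.subset_diff[OF sub']) simp
    also have "(\<Prod>c\<in>cells (Suc m) f - cells m (sh T). x (T c)) =
        (\<Prod>c\<in>cells (Suc m) f - cells m (sh T). x m)"
      by (rule prod.cong) (use eqm[OF T] in \<open>auto simp del: mem_cells\<close>)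
    also have "\<dots> = x m ^ (card (cells (Suc m) f) - card (cells m (sh T)))"
      using sub' by (simp add: card_Diff_subset)
    \<comment> \<open>The erased cells are the full last row and the ends of the other rows; since
      \<open>sh T j\<close> never exceeds \<open>f j\<close>, no subtraction is truncated.\<close>
    also have "card (cells (Suc m) f) - card (cells m (sh T)) = f m + (\<Sum>j<m. f j - sh T j)"
    proof -
      have "(\<Sum>j<m. f j - sh T j) = (\<Sum>j<m. f j) - (\<Sum>j<m. sh T j)"
        using sh_le[of _ T] by (intro sum_subtractf_nat) simp
      moreover have "(\<Sum>j<m. sh T j) \<le> (\<Sum>j<m. f j)"
        using sh_le[of _ T] by (intro sum_mono) simp
      ultimately show ?thesis by (simp add: cells_def)
    qed
    finally show "(case fw T of (g, T) \<Rightarrow> (\<Prod>c\<in>cells m g. x (T c)) * x m ^ (f m + (\<Sum>j<m. f j - g j))) =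
        (\<Prod>c\<in>cells (Suc m) f. x (T c))"
      by (simp add: fw_def mult_ac)
  next
    fix b assume "b \<in> Sigma G (tableaux m)"
    then obtain g T where b: "b = (g, T)" and g: "g \<in> G" and T: "T \<in> tableaux m g" by auto
    show "bw b \<in> tableaux (Suc m) f" using bwT[OF g T] b by simp
    have "restrict (bw (g, T)) (cells m g) = T"
    proof
      fix c
      show "restrict (bw (g, T)) (cells m g) c = T c"
        using extensional_arb[OF tableauxD(1)[OF T], of c] sub[OF g] by (cases "c \<in> cells m g") (auto simp: bw_def)
    qed
    then show "fw (bw b) = b" by (simp add: b fw_def sh_bw[OF g T])
  qed
  also have "\<dots> = (\<Sum>g\<in>G. \<Sum>T\<in>tableaux m g.
      (\<Prod>c\<in>cells m g. x (T c)) * x m ^ (f m + (\<Sum>j<m. f j - g j)))"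
    by (rule sum.Sigma[symmetric]) (auto simp: G_def finite_PiE)
  finally show ?thesis
    by (simp add: tableau_sum_def G_def sum_distrib_right)
qed

section \<open>The bialternant formula\<close>

text \<open>Both sides obey the same recursion: subtracting the staircase \<open>m - 1 - j\<close>
  turns the half-open ranges of \<open>alternant_Suc\<close> into the closed ranges of
  \<open>tableau_sum_Suc\<close> and matches the exponents of \<open>x m\<close>. Being free of
  division, the formula holds over every commutative ring.\<close>

theorem alternant_eq_tableau_sum:
  fixes x :: "nat \<Rightarrow> 'a::comm_ring_1"
  assumes "\<And>i j. i < j \<Longrightarrow> j < m \<Longrightarrow> f j \<le> f i"
  shows "alternant m (\<lambda>j. f j + (m - 1 - j)) x = (\<Prod>j<m. \<Prod>i<j. x i - x j) * tableau_sum m f x"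
  using assms
proof (induction m arbitrary: f)
  case 0
  have "tableaux 0 f = {\<lambda>_. undefined}" by (auto simp: tableaux_def cells_def)
  then show ?case by (simp add: alternant_def tableau_sum_def cells_def)
next
  case (Suc m)
  define v where "v j = f j + (m - j)" for j
  define G where "G = (\<Pi>\<^sub>E j\<in>{..<m}. {f (Suc j)..f j})"
  define W where "W = (\<Pi>\<^sub>E j\<in>{..<m}. {v (Suc j)..<v j})"
  have "alternant (Suc m) v x = (\<Prod>i<m. x i - x m) *
      (\<Sum>w\<in>W. alternant m w x * x m ^ (v m + (\<Sum>j<m. v j - 1 - w j)))"
    unfolding W_def
  proof (rule alternant_Suc)
    fix j assume "j < m"
    then show "v (Suc j) \<le> v j" using Suc.prems[of j "Suc j"] by (simp add: v_def)
  qed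
  also have "(\<Sum>w\<in>W. alternant m w x * x m ^ (v m + (\<Sum>j<m. v j - 1 - w j))) =
      (\<Sum>g\<in>G. (\<Prod>j<m. \<Prod>i<j. x i - x j) * (tableau_sum m g x * x m ^ (f m + (\<Sum>j<m. f j - g j))))"
  proof (rule sum.reindex_bij_witness[where i = "\<lambda>g. \<lambda>j\<in>{..<m}. g j + (m - 1 - j)"
        and j = "\<lambda>w. \<lambda>j\<in>{..<m}. w j - (m - 1 - j)"])
    fix w assume w: "w \<in> W"
    have b: "f (Suc j) + (m - 1 - j) \<le> w j" "w j < f j + (m - j)" if "j < m" for j
      using w that by (auto simp: W_def v_def PiE_def Pi_iff)
    let ?g = "\<lambda>j\<in>{..<m}. w j - (m - 1 - j)"
    show inv: "(\<lambda>j\<in>{..<m}. ?g j + (m - 1 - j)) = w"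
    proof
      fix j
      show "(\<lambda>j\<in>{..<m}. ?g j + (m - 1 - j)) j = w j"
        using b[of j] PiE_arb[OF w[unfolded W_def], of j] by (cases "j < m") auto
    qed
    show gG: "?g \<in> G"
      unfolding G_def
    proof (rule PiE_I)
      fix j assume "j \<in> {..<m}"
      then have j: "j < m" by simp
      have "f (Suc j) \<le> w j - (m - 1 - j)" "w j - (m - 1 - j) \<le> f j"
        using b[OF j] by linarith+
      then show "?g j \<in> {f (Suc j)..f j}" using j by simp
    qed simp
    \<comment> \<open>Interlacing with \<open>f\<close> makes the smaller shape a partition again,
      as the induction hypothesis requires.\<close>
    have "?g j \<le> ?g i" if "i < j" "j < m" for i j
    proof -
      have "?g j \<in> {f (Suc j)..f j}" "?g i \<in> {f (Suc i)..f i}"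
        by (rule PiE_mem[OF gG[unfolded G_def]]; use that in simp)+
      moreover have "f j \<le> f (Suc i)"
        using that Suc.prems[of "Suc i" j] by (cases "j = Suc i") simp_all
      ultimately show ?thesis by (meson atLeastAtMost_iff order_trans)
    qed
    then have *: "alternant m (\<lambda>j. ?g j + (m - 1 - j)) x = (\<Prod>j<m. \<Prod>i<j. x i - x j) * tableau_sum m ?g x"
      by (rule Suc.IH)
    have w_alt: "alternant m (\<lambda>j. ?g j + (m - 1 - j)) x = alternant m w x"
    proof (rule alternant_cong)
      fix j assume "j < m"
      then show "?g j + (m - 1 - j) = w j" using fun_cong[OF inv, of j] by simp
    qed simp
    have w_exp: "(\<Sum>j<m. f j - ?g j) = (\<Sum>j<m. v j - 1 - w j)"
    proof (rule sum.cong)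
      fix j assume "j \<in> {..<m}"
      then show "f j - ?g j = v j - 1 - w j" using b[of j] by (simp add: v_def)
    qed simp
    have "v m = f m" by (simp add: v_def)
    then show "(\<Prod>j<m. \<Prod>i<j. x i - x j) * (tableau_sum m ?g x * x m ^ (f m + (\<Sum>j<m. f j - ?g j))) =
        alternant m w x * x m ^ (v m + (\<Sum>j<m. v j - 1 - w j))"
      unfolding w_exp w_alt[symmetric] * by (simp only: mult.assoc)
  next
    fix g assume g: "g \<in> G"
    show "(\<lambda>j\<in>{..<m}. (\<lambda>j\<in>{..<m}. g j + (m - 1 - j)) j - (m - 1 - j)) = g"
    proof
      fix j
      show "(\<lambda>j\<in>{..<m}. (\<lambda>j\<in>{..<m}. g j + (m - 1 - j)) j - (m - 1 - j)) j = g j"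
        using PiE_arb[OF g[unfolded G_def], of j] by (cases "j < m") simp_all
    qed
    show "(\<lambda>j\<in>{..<m}. g j + (m - 1 - j)) \<in> W"
      unfolding W_def
    proof (rule PiE_I)
      fix j assume "j \<in> {..<m}"
      moreover from this have "f (Suc j) \<le> g j" "g j \<le> f j" using g by (auto simp: G_def PiE_def Pi_iff)
      ultimately show "(\<lambda>j\<in>{..<m}. g j + (m - 1 - j)) j \<in> {v (Suc j)..<v j}"
        by (auto simp: v_def)
    qed simp
  qed
  also have "(\<Prod>i<m. x i - x m) * \<dots> = (\<Prod>j<Suc m. \<Prod>i<j. x i - x j) * tableau_sum (Suc m) f x"
    by (subst tableau_sum_Suc[OF Suc.prems]) (auto simp: G_def sum_distrib_left mult_ac)
  finally show ?case by (simp add: v_def[abs_def])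
qed

text \<open>Semistandardness involves only the order of the row labels and of the entries, so both
  can be relabelled along the increasing map \<open>e\<close>.\<close>

lemma schur_eq_tableau_sum:
  assumes e: "strict_mono_on {..<m} e"
  shows "schur (e ` {..<m}) lam = tableau_sum m (\<lambda>i. Poly_Mapping.lookup lam (e i)) (\<lambda>i. var (e i))"
proof -
  let ?J = "e ` {..<m}"
  define f where "f i = Poly_Mapping.lookup lam (e i)" for i
  define d where "d = the_inv_into {..<m} e"
  have inj: "inj_on e {..<m}" using e by (rule strict_mono_on_imp_inj_on)
  have de [simp]: "d (e i) = i" if "i < m" for i
    unfolding d_def using inj that by (simp add: the_inv_into_f_f)
  have dJ: "d a < m" "e (d a) = a" if "a \<in> ?J" for a using that by auto
  have e_less: "e i < e j \<longleftrightarrow> i < j" if "i < m" "j < m" for i j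
    using strict_mono_on_less[OF e] that by simp
  have e_le: "e i \<le> e j \<longleftrightarrow> i \<le> j" if "i < m" "j < m" for i j
    using e_less[of j i] that by auto
  have bx: "(a, q) \<in> boxes ?J lam \<longleftrightarrow> a \<in> ?J \<and> q < Poly_Mapping.lookup lam a" for a q
    by (auto simp: boxes_def)
  define fw where "fw T = (\<lambda>(i, q)\<in>cells m f. d (T (e i, q)))" for T
  define bw where "bw T = (\<lambda>(a, q)\<in>boxes ?J lam. e (T (d a, q)))" for T
  have bij: "bij_betw (\<lambda>(i, q). (e i, q)) (cells m f) (boxes ?J lam)"
    by (rule bij_betw_byWitness[where f' = "\<lambda>(a, q). (d a, q)"]) (auto simp: bx f_def)
  show ?thesis
    unfolding schur_def tableau_sum_def f_def[symmetric]
  proof (rule sum.reindex_bij_witness[where i = bw and j = fw])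
    fix T assume T: "T \<in> ssyt ?J lam"
    have TJ: "T (e i, q) \<in> ?J" if "i < m" "q < f i" for i q
      using T that bx[of "e i" q] unfolding ssyt_def f_def by (auto simp: PiE_iff)
    have ext: "T \<in> extensional (boxes ?J lam)" using T by (auto simp: ssyt_def PiE_iff)
    show "bw (fw T) = T"
    proof
      fix c :: "nat \<times> nat"
      obtain a q where c: "c = (a, q)" by (cases c)
      show "bw (fw T) c = T c"
      proof (cases "c \<in> boxes ?J lam")
        case True
        then obtain i where i: "a = e i" "i < m" "q < f i" by (auto simp: c bx f_def)
        then show ?thesis using True TJ[of i q] dJ(2) by (simp add: bw_def fw_def c)
      next
        case False
        then show ?thesis using ext by (auto simp: bw_def extensional_def c)
      qed
    qed
    show "fw T \<in> tableaux m f"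
    proof (rule tableauxI)
      fix i q assume "i < m" "q < f i"
      then show "fw T (i, q) < m" using TJ[of i q] dJ(1) by (simp add: fw_def)
    next
      fix i p q assume *: "i < m" "p < q" "q < f i"
      then have "T (e i, p) \<le> T (e i, q)"
        using T bx[of "e i" p] bx[of "e i" q] unfolding ssyt_def f_def by simp
      then have "d (T (e i, p)) \<le> d (T (e i, q))"
        using TJ[of i p] TJ[of i q] dJ e_le * by (metis dual_order.strict_trans)
      then show "fw T (i, p) \<le> fw T (i, q)" using * by (simp add: fw_def)
    next
      fix i j q assume *: "i < j" "j < m" "q < f i" "q < f j"
      then have "T (e i, q) < T (e j, q)"
        using T bx[of "e i" q] bx[of "e j" q] e_less[of i j] unfolding ssyt_def f_def by simp
      then have "d (T (e i, q)) < d (T (e j, q))"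
        using TJ[of i q] TJ[of j q] dJ e_less * by (metis dual_order.strict_trans)
      then show "fw T (i, q) < fw T (j, q)" using * by (simp add: fw_def)
    qed (simp add: fw_def)
    have "(\<Prod>c\<in>cells m f. var (e (fw T c))) = (\<Prod>c\<in>cells m f. var (T (case c of (i, q) \<Rightarrow> (e i, q))))"
      by (rule prod.cong) (auto simp: fw_def dJ(2)[OF TJ])
    also have "\<dots> = (\<Prod>c\<in>boxes ?J lam. var (T c))"
      by (rule prod.reindex_bij_betw[OF bij])
    finally show "(\<Prod>c\<in>cells m f. var (e (fw T c))) = (\<Prod>c\<in>boxes ?J lam. var (T c))" .
  next
    fix T assume T: "T \<in> tableaux m f"
    show "fw (bw T) = T"
    proof
      fix c :: "nat \<times> nat"
      obtain i q where c: "c = (i, q)" by (cases c)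
      show "fw (bw T) c = T c"
        using tableauxD(1)[OF T] tableauxD(2)[OF T, of i q] 
        by (cases "i < m \<and> q < f i") (auto simp: fw_def bw_def c extensional_def bx f_def)
    qed
    show "bw T \<in> ssyt ?J lam"
      unfolding ssyt_def
    proof (intro CollectI conjI allI impI)
      show "bw T \<in> boxes ?J lam \<rightarrow>\<^sub>E ?J"
        using tableauxD(2)[OF T] by (auto simp: bw_def bx f_def)
    next
      fix a p q assume "(a, p) \<in> boxes ?J lam \<and> (a, q) \<in> boxes ?J lam \<and> p < q"
      then show "bw T (a, p) \<le> bw T (a, q)"
        using tableauxD(2)[OF T, of "d a" p] tableauxD(2)[OF T, of "d a" q] tableauxD(3)[OF T, of "d a" p q] 
        by (auto simp: bw_def bx f_def e_le)
    next
      fix a b q assume "(a, q) \<in> boxes ?J lam \<and> (b, q) \<in> boxes ?J lam \<and> a < b"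
      then show "bw T (a, q) < bw T (b, q)"
        using tableauxD(2)[OF T, of "d a" q] tableauxD(2)[OF T, of "d b" q] tableauxD(4)[OF T, of "d a" "d b" q] 
        by (auto simp: bw_def bx f_def e_less)
    qed
  qed
qed

section \<open>Symmetric and antisymmetric polynomials\<close>

text \<open>\<open>map_key\<close> precomposes the exponent vector with the transposition. A
  transposition is its own inverse, so this is also the action that moves the exponent of each
  variable to its image.\<close>

definition swap_exp :: "nat \<Rightarrow> nat \<Rightarrow> monomial \<Rightarrow> monomial" where
  "swap_exp a b m = Poly_Mapping.map_key (transpose a b) m"

definition swap_vars :: "nat \<Rightarrow> nat \<Rightarrow> mpoly \<Rightarrow> mpoly" where
  "swap_vars a b P = Poly_Mapping.map_key (swap_exp a b) P"

lemma lookup_swap_exp: "Poly_Mapping.lookup (swap_exp a b m) i = Poly_Mapping.lookup m (transpose a b i)"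
  by (simp add: swap_exp_def map_key.rep_eq inj_transpose)

lemma swap_exp_swap_exp [simp]: "swap_exp a b (swap_exp a b m) = m"
  by (rule poly_mapping_eqI) (simp add: lookup_swap_exp)

lemma inj_swap_exp [simp]: "inj (swap_exp a b)"
  by (rule inj_on_inverseI[where g = "swap_exp a b"]) simp

lemma swap_exp_add: "swap_exp a b (m + n) = swap_exp a b m + swap_exp a b n"
  by (rule poly_mapping_eqI) (simp add: lookup_swap_exp lookup_add)

lemma lookup_swap_vars: "Poly_Mapping.lookup (swap_vars a b P) m = Poly_Mapping.lookup P (swap_exp a b m)"
  by (simp add: swap_vars_def map_key.rep_eq)

lemma swap_vars_single: "swap_vars a b (Poly_Mapping.single m c) = Poly_Mapping.single (swap_exp a b m) c"
proof (rule poly_mapping_eqI)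
  fix n
  have "m = swap_exp a b n \<longleftrightarrow> swap_exp a b m = n" by auto
  then show "Poly_Mapping.lookup (swap_vars a b (Poly_Mapping.single m c)) n =
      Poly_Mapping.lookup (Poly_Mapping.single (swap_exp a b m) c) n"
    by (simp add: lookup_swap_vars lookup_single)
qed

lemma swap_vars_zero: "swap_vars a b 0 = 0"
  by (rule poly_mapping_eqI) (simp add: lookup_swap_vars)

lemma swap_vars_add: "swap_vars a b (P + Q) = swap_vars a b P + swap_vars a b Q"
  by (rule poly_mapping_eqI) (simp add: lookup_swap_vars lookup_add)

lemma swap_vars_diff: "swap_vars a b (P - Q) = swap_vars a b P - swap_vars a b Q"
  by (rule poly_mapping_eqI) (simp add: lookup_swap_vars lookup_minus)

text \<open>Both sides are additive in \<open>P\<close> and in \<open>Q\<close>, and polynomials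
  form the free abelian group on the monomials. It therefore suffices to compare products of two
  monomials, where \<open>swap_exp_add\<close> applies.\<close>

lemma swap_vars_mult: "swap_vars a b (P * Q) = swap_vars a b P * swap_vars a b Q"
proof (rule frag_induction[where c = P and S = UNIV and
      P = "\<lambda>P. swap_vars a b (P * Q) = swap_vars a b P * swap_vars a b Q"])
  fix x
  show "swap_vars a b (frag_of x * Q) = swap_vars a b (frag_of x) * swap_vars a b Q"
  proof (rule frag_induction[where c = Q and S = UNIV and
        P = "\<lambda>Q. swap_vars a b (frag_of x * Q) = swap_vars a b (frag_of x) * swap_vars a b Q"])
    fix y
    show "swap_vars a b (frag_of x * frag_of y) = swap_vars a b (frag_of x) * swap_vars a b (frag_of y)"
      by (simp add: mult_single swap_vars_single swap_exp_add)
  qed (simp_all add: swap_vars_diff right_diff_distrib swap_vars_zero)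
qed (simp_all add: swap_vars_diff left_diff_distrib swap_vars_zero)

interpretation swap_vars: comm_ring_hom "swap_vars a b" for a b
proof
  show "swap_vars a b 1 = 1"
    using swap_vars_single[of a b 0 1] by (simp add: swap_exp_def)
qed (simp_all add: swap_vars_mult swap_vars_add swap_vars_zero)

lemma swap_vars_var: "swap_vars a b (var i) = var (transpose a b i)"
proof -
  have "swap_exp a b (Poly_Mapping.single i 1) = Poly_Mapping.single (transpose a b i) 1"
    by (rule poly_mapping_eqI) (auto simp: lookup_swap_exp lookup_single when_def transpose_def)
  then show ?thesis by (simp add: var_def swap_vars_single)
qed

lemma swap_vars_alternant: "swap_vars a b (alternant m v x) = alternant m v (\<lambda>i. swap_vars a b (x i))"
  unfolding alternant_def swap_vars.hom_det[symmetric]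
  by (intro arg_cong[where f = det] eq_matI) (auto simp: swap_vars.hom_power)

lemma alternant_transpose:
  assumes "i < m" "j < m" "i \<noteq> j"
  shows "alternant m v (\<lambda>l. x (transpose i j l)) = - alternant m v x"
proof -
  have p: "transpose i j permutes {0..<m}" using assms by (intro permutes_swap_id) auto
  have "alternant m v (\<lambda>l. x (transpose i j l)) =
      det (mat m m (\<lambda>(l, c). mat m m (\<lambda>(l, c). x l ^ v c) $$ (transpose i j l, c)))"
    unfolding alternant_def
    by (intro arg_cong[where f = det] eq_matI) (use permutes_in_image[OF p] in auto)
  also have "\<dots> = - alternant m v x"
    by (subst det_permute_rows[OF _ p]) (use assms in \<open>auto simp: alternant_def sign_swap_id\<close>)
  finally show ?thesis .
qed

text \<open>In the lexicographically largest monomial of an antisymmetric polynomial, the exponents decrease.\<close>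

lemma antisymmetric_eq_0I:
  assumes swap: "\<And>a b. (a, b) \<in> R \<Longrightarrow> swap_vars a b P = - P"
    and less: "\<And>a b. (a, b) \<in> R \<Longrightarrow> a < b"
    and zero: "\<And>m. (\<And>a b. (a, b) \<in> R \<Longrightarrow> Poly_Mapping.lookup m b < Poly_Mapping.lookup m a) \<Longrightarrow>
      Poly_Mapping.lookup P m = 0"
  shows "P = 0"
proof (rule ccontr)
  assume "P \<noteq> 0"
  then have ne: "Poly_Mapping.keys P \<noteq> {}" by simp
  define m where "m = Max (Poly_Mapping.keys P)"
  have m: "m \<in> Poly_Mapping.keys P" unfolding m_def using ne by (intro Max_in) auto
  have "Poly_Mapping.lookup m b < Poly_Mapping.lookup m a" if R: "(a, b) \<in> R" for a b
  proof (rule ccontr)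
    assume *: "\<not> Poly_Mapping.lookup m b < Poly_Mapping.lookup m a"
    have sw: "Poly_Mapping.lookup P (swap_exp a b m) = - Poly_Mapping.lookup P m"
      using lookup_swap_vars[of a b P m] swap[OF R] by simp
    \<comment> \<open>A monomial fixed by the exchange would have a coefficient equal to its own
      negative, hence \<open>0\<close>.\<close>
    have "m \<noteq> swap_exp a b m"
    proof
      assume "m = swap_exp a b m"
      then show False using sw m by (simp add: in_keys_iff)
    qed
    then have "Poly_Mapping.lookup m a \<noteq> Poly_Mapping.lookup m b"
      by (auto simp: poly_mapping_eq_iff lookup_swap_exp fun_eq_iff transpose_def split: if_splits)
    with * have "Poly_Mapping.lookup m a < Poly_Mapping.lookup m b" by simp
    \<comment> \<open>Monomials are compared at the smallest index where they differ. Exchanging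
      moves the larger exponent to the smaller index \<open>a\<close>, which gives a larger monomial
      that still occurs in \<open>P\<close>.\<close>
    then have "m < swap_exp a b m"
      unfolding less_poly_mapping.rep_eq less_fun_def
      using less[OF R] by (intro exI[of _ a]) (auto simp: lookup_swap_exp transpose_def)
    moreover have "swap_exp a b m \<in> Poly_Mapping.keys P" using sw m by (simp add: in_keys_iff)
    ultimately show False unfolding m_def using Max_ge[OF finite_keys] by (meson leD)
  qed
  then have "Poly_Mapping.lookup P m = 0" by (rule zero)
  then show False using m by (simp add: in_keys_iff)
qed

section \<open>Homogeneity, and the symmetry of complete homogeneous polynomials\<close>

text \<open>Serves to show that a monomial \<open>nu + rho Psi\<close> occurring in the product of
  the Vandermonde polynomial and the character has \<open>nu\<close> of the size and support of a
  highest weight. The zero polynomial is homogeneous of every degree.\<close>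

definition homogeneous :: "nat set \<Rightarrow> nat \<Rightarrow> mpoly \<Rightarrow> bool" where
  "homogeneous V n P \<longleftrightarrow> (\<forall>m\<in>Poly_Mapping.keys P. Poly_Mapping.keys m \<subseteq> V \<and>
     (\<Sum>i\<in>V. Poly_Mapping.lookup m i) = n)"

lemma homogeneous_one: "homogeneous V 0 1"
  by (simp add: homogeneous_def)

lemma homogeneous_var: "finite V \<Longrightarrow> i \<in> V \<Longrightarrow> homogeneous V 1 (var i)"
  by (simp add: homogeneous_def var_def lookup_single when_def)

lemma homogeneous_diff: "homogeneous V n P \<Longrightarrow> homogeneous V n Q \<Longrightarrow> homogeneous V n (P - Q)"
  using keys_diff[of P Q] by (auto simp: homogeneous_def)

lemma homogeneous_mult:
  assumes "homogeneous V n P" "homogeneous V n' Q"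
  shows "homogeneous V (n + n') (P * Q)"
  unfolding homogeneous_def
proof
  fix m assume "m \<in> Poly_Mapping.keys (P * Q)"
  then obtain p q where m: "m = p + q" and "p \<in> Poly_Mapping.keys P" "q \<in> Poly_Mapping.keys Q"
    using keys_mult[of P Q] by blast
  then show "Poly_Mapping.keys m \<subseteq> V \<and> (\<Sum>i\<in>V. Poly_Mapping.lookup m i) = n + n'"
    using assms keys_add[of p q] by (fastforce simp: homogeneous_def lookup_add sum.distrib)
qed

lemma homogeneous_power: "homogeneous V n P \<Longrightarrow> homogeneous V (n * l) (P ^ l)"
  by (induction l) (auto simp: homogeneous_one dest: homogeneous_mult)

lemma homogeneous_prod:
  "finite A \<Longrightarrow> (\<And>x. x \<in> A \<Longrightarrow> homogeneous V 1 (P x)) \<Longrightarrow> homogeneous V (card A) (\<Prod>x\<in>A. P x)"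
  by (induction A rule: finite_induct)
     (auto simp: homogeneous_one dest: homogeneous_mult[where n = 1, simplified])

text \<open>Such a monomial is determined by its exponents on \<open>V\<close>, each at most
  \<open>n\<close>. Finiteness makes the sum defining \<open>complete_homogeneous\<close> a genuine
  one, since a sum over an infinite set would be \<open>0\<close>.\<close>

lemma finite_monomials:
  assumes "finite V"
  shows "finite {m :: monomial. Poly_Mapping.keys m \<subseteq> V \<and> (\<Sum>i\<in>V. Poly_Mapping.lookup m i) = n}"
    (is "finite ?S")
proof -
  have "inj_on (\<lambda>m. restrict (Poly_Mapping.lookup m) V) ?S"
  proof (rule inj_onI, rule poly_mapping_eqI)
    fix m m' :: monomial and i
    assume *: "m \<in> ?S" "m' \<in> ?S" "restrict (Poly_Mapping.lookup m) V = restrict (Poly_Mapping.lookup m') V"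
    show "Poly_Mapping.lookup m i = Poly_Mapping.lookup m' i"
    proof (cases "i \<in> V")
      case True
      then show ?thesis using fun_cong[OF *(3), of i] by simp
    next
      case False
      then have "i \<notin> Poly_Mapping.keys m" "i \<notin> Poly_Mapping.keys m'" using * by auto
      then show ?thesis by (simp add: in_keys_iff)
    qed
  qed
  moreover have "(\<lambda>m. restrict (Poly_Mapping.lookup m) V) ` ?S \<subseteq> V \<rightarrow>\<^sub>E {..n}"
    using assms by (auto intro: member_le_sum)
  moreover have "finite (V \<rightarrow>\<^sub>E {..n})" using assms by (simp add: finite_PiE)
  ultimately show ?thesis by (meson finite_imageD finite_subset)
qed

lemma lookup_complete_homogeneous:
  assumes "finite V"
  shows "Poly_Mapping.lookup (complete_homogeneous V n) m =
    (if Poly_Mapping.keys m \<subseteq> V \<and> (\<Sum>i\<in>V. Poly_Mapping.lookup m i) = n then 1 else 0)"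
  by (simp add: complete_homogeneous_def lookup_sum finite_monomials[OF assms])

lemma homogeneous_complete_homogeneous: "finite V \<Longrightarrow> homogeneous V n (complete_homogeneous V n)"
  unfolding homogeneous_def by (metis in_keys_iff lookup_complete_homogeneous)

lemma swap_vars_complete_homogeneous:
  assumes "finite V" "a \<in> V" "b \<in> V"
  shows "swap_vars a b (complete_homogeneous V n) = complete_homogeneous V n"
proof (rule poly_mapping_eqI)
  fix m
  have p: "transpose a b permutes V" using assms by (intro permutes_swap_id)
  have *: "Poly_Mapping.keys (swap_exp a b m) \<subseteq> V" if "Poly_Mapping.keys m \<subseteq> V" for m
  proof
    fix i assume "i \<in> Poly_Mapping.keys (swap_exp a b m)"
    then have "transpose a b i \<in> V" using that by (auto simp: in_keys_iff lookup_swap_exp)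
    then show "i \<in> V" using permutes_in_image[OF p] by simp
  qed
  have "Poly_Mapping.keys (swap_exp a b m) \<subseteq> V \<longleftrightarrow> Poly_Mapping.keys m \<subseteq> V"
    using *[of m] *[of "swap_exp a b m"] by auto
  moreover have "(\<Sum>i\<in>V. Poly_Mapping.lookup (swap_exp a b m) i) = (\<Sum>i\<in>V. Poly_Mapping.lookup m i)"
    using sum.permute[OF p, of "Poly_Mapping.lookup m"] by (simp add: lookup_swap_exp o_def)
  ultimately show "Poly_Mapping.lookup (swap_vars a b (complete_homogeneous V n)) m =
      Poly_Mapping.lookup (complete_homogeneous V n) m"
    by (simp add: lookup_swap_vars lookup_complete_homogeneous[OF assms(1)])
qed

section \<open>The shift operator\<close>

text \<open>Cancellation can shrink the support of a sum of polynomials; allowing a larger index set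
  lets two shift operators be added over a common one.\<close>

lemma shift_op_superset:
  assumes "finite A" "Poly_Mapping.keys P \<subseteq> A"
  shows "shift_op P f M =
    (\<Sum>\<beta>\<in>A. Poly_Mapping.lookup P \<beta> * f (\<lambda>i. M i - int (Poly_Mapping.lookup \<beta> i)))"
  unfolding shift_op_def using assms by (intro sum.mono_neutral_left) (auto simp: in_keys_iff)

lemma shift_op_add: "shift_op (P + Q) f M = shift_op P f M + shift_op Q f M"
proof -
  let ?A = "Poly_Mapping.keys P \<union> Poly_Mapping.keys Q"
  show ?thesis
    using keys_add[of P Q]
    by (simp add: shift_op_superset[where A = ?A] lookup_add distrib_right sum.distrib)
qed

lemma shift_op_single:
  "shift_op (Poly_Mapping.single \<beta> c) f M = c * f (\<lambda>i. M i - int (Poly_Mapping.lookup \<beta> i))"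
  by (subst shift_op_superset[where A = "{\<beta>}"]) auto

lemma shift_op_sum: "shift_op (\<Sum>x\<in>A. P x) f M = (\<Sum>x\<in>A. shift_op (P x) f M)"
  by (induction A rule: infinite_finite_induct) (auto simp: shift_op_add, auto simp: shift_op_def)

lemma prod_single:
  fixes f :: "'a \<Rightarrow> 'b::comm_monoid_add" and c :: "'a \<Rightarrow> 'c::comm_semiring_1"
  shows "(\<Prod>x\<in>A. Poly_Mapping.single (f x) (c x)) = Poly_Mapping.single (\<Sum>x\<in>A. f x) (\<Prod>x\<in>A. c x)"
  by (induction A rule: infinite_finite_induct) (auto simp: mult_single)

lemma lookup_single_mult:
  fixes Q :: mpoly
  shows "Poly_Mapping.lookup (Poly_Mapping.single m c * Q) (m + n) = c * Poly_Mapping.lookup Q n"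
  by (simp add: lookup_mult lookup_single when_mult)

lemma lookup_single_mult_eq_0:
  fixes Q :: mpoly
  assumes "\<And>n. k \<noteq> m + n"
  shows "Poly_Mapping.lookup (Poly_Mapping.single m c * Q) k = 0"
  using assms by (simp add: lookup_mult lookup_single when_mult)

section \<open>Comparison of the Weyl denominator with the Vandermonde product\<close>

text \<open>For the positive roots of the blocks this differs from half the sum of the roots by a
  constant on each block. It keeps all exponents nonnegative integers and is the staircase of the
  bialternant formula.\<close>

definition rho :: "(nat \<times> nat) set \<Rightarrow> monomial" where
  "rho Psi = (\<Sum>(a, b)\<in>Psi. Poly_Mapping.single a 1)"

definition vandermonde :: "(nat \<times> nat) set \<Rightarrow> mpoly" where
  "vandermonde Psi = (\<Prod>(a, b)\<in>Psi. var a - var b)"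

text \<open>\<open>S\<close> is the set of roots whose factor contributes its negative term.
  \<open>vandermonde_expand\<close> uses the same index set, with \<open>- var b\<close> chosen for
  the roots in \<open>S\<close> and \<open>var a\<close> for the others, so the two sums can be
  compared term by term.\<close>

lemma weyl_denominator_expand:
  assumes "finite Psi"
  shows "weyl_denominator Psi = (\<Sum>S\<in>Pow Psi. Poly_Mapping.single
    (\<Sum>(a, b)\<in>S. \<Sum>i\<in>{a..<b}. Poly_Mapping.single i 1) ((- 1) ^ card S))"
proof -
  have "weyl_denominator Psi =
      (\<Prod>p\<in>Psi. Poly_Mapping.single (\<Sum>i\<in>{fst p..<snd p}. Poly_Mapping.single i 1) (- 1) + 1)"
    by (simp add: weyl_denominator_def var_def prod_single case_prod_beta single_uminus)
  also have "\<dots> = (\<Sum>S\<in>Pow Psi. \<Prod>p\<in>S. Poly_Mapping.single (\<Sum>i\<in>{fst p..<snd p}. Poly_Mapping.single i 1) (- 1))"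
    using assms by (simp add: prod_add)
  finally show ?thesis by (simp add: prod_single case_prod_beta)
qed

lemma vandermonde_expand:
  assumes "finite Psi"
  shows "vandermonde Psi = (\<Sum>S\<in>Pow Psi. Poly_Mapping.single
    ((\<Sum>(a, b)\<in>S. Poly_Mapping.single b 1) + rho (Psi - S)) ((- 1) ^ card S))"
proof -
  have "vandermonde Psi = (\<Prod>p\<in>Psi. Poly_Mapping.single (Poly_Mapping.single (snd p) 1) (- 1) +
      Poly_Mapping.single (Poly_Mapping.single (fst p) 1) 1)"
    by (simp add: vandermonde_def var_def case_prod_beta single_uminus)
  also have "\<dots> = (\<Sum>S\<in>Pow Psi. (\<Prod>p\<in>S. Poly_Mapping.single (Poly_Mapping.single (snd p) 1) (- 1)) *
      (\<Prod>p\<in>Psi - S. Poly_Mapping.single (Poly_Mapping.single (fst p) 1) 1))"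
    using assms by (rule prod_add)
  finally show ?thesis by (simp add: prod_single mult_single rho_def case_prod_beta)
qed

text \<open>Lowering \<open>M\<close> by one on \<open>{a..<b}\<close> raises the difference
  \<open>M (a - 1) - M a\<close> by one and lowers \<open>M (b - 1) - M b\<close> by one. Shifting
  by a root thus reads off the coefficient that multiplication by the quotient of
  \<open>var b\<close> by \<open>var a\<close> would move to \<open>lam\<close>; adding
  \<open>rho Psi\<close> clears the denominators.\<close>

lemma shift_weyl_denominator:
  assumes fin: "finite Psi"
    and Psi: "\<And>a b. (a, b) \<in> Psi \<Longrightarrow> 1 \<le> a \<and> a < b \<and> b \<le> r + 1"
    and lam: "Poly_Mapping.keys lam \<subseteq> {1..r+1}"
    and M0: "M 0 = int (d * L)" and Mr: "M (r + 1) = 0"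
    and lamM: "\<And>j. j \<in> {1..r+1} \<Longrightarrow> int (Poly_Mapping.lookup lam j) = M (j - 1) - M j"
  shows "shift_op (weyl_denominator Psi) (coeff_c r d L) M =
    Poly_Mapping.lookup (vandermonde Psi * sym_char r d ^ L) (lam + rho Psi)"
proof -
  let ?C = "sym_char r d ^ L"
  let ?beta = "\<lambda>S. \<Sum>(a, b)\<in>S. \<Sum>i\<in>{a..<b}. Poly_Mapping.single i 1 :: monomial"
  let ?tail = "\<lambda>S. \<Sum>(a, b)\<in>S. Poly_Mapping.single b 1 :: monomial"
  have "(- 1) ^ card S * coeff_c r d L (\<lambda>i. M i - int (Poly_Mapping.lookup (?beta S) i)) =
      Poly_Mapping.lookup (Poly_Mapping.single (?tail S + rho (Psi - S)) ((- 1) ^ card S) * ?C) (lam + rho Psi)"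
    if S: "S \<subseteq> Psi" for S
  proof -
    let ?m = "?tail S + rho (Psi - S)"
    have finS: "finite S" using S fin finite_subset by blast
    define N where "N i = M i - int (Poly_Mapping.lookup (?beta S) i)" for i
    \<comment> \<open>The exponent vector at which the summand of \<open>S\<close> reads its
      coefficient. It is integer valued because exponents may become negative.\<close>
    define p where "p j = pad r (d * L) N (j - 1) - pad r (d * L) N j" for j
    have beta: "Poly_Mapping.lookup (?beta S) j = (\<Sum>(a, b)\<in>S. if a \<le> j \<and> j < b then 1 else 0)" for j
      by (simp add: lookup_sum case_prod_beta lookup_single when_def del: One_nat_def)
    have tail: "Poly_Mapping.lookup (?tail S) j = (\<Sum>(a, b)\<in>S. if b = j then 1 else 0)" for j
      by (simp add: lookup_sum case_prod_beta lookup_single when_def del: One_nat_def)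
    have rho: "Poly_Mapping.lookup (rho S) j = (\<Sum>(a, b)\<in>S. if a = j then 1 else 0)" for j
      by (simp add: rho_def lookup_sum case_prod_beta lookup_single when_def del: One_nat_def)
    \<comment> \<open>A root \<open>(a, b)\<close> raises the shift at \<open>a\<close> and lowers
      it again at \<open>b\<close>. The identity is written with sums only, to avoid subtraction of
      naturals.\<close>
    have step: "Poly_Mapping.lookup (?beta S) j + Poly_Mapping.lookup (?tail S) j =
        Poly_Mapping.lookup (?beta S) (j - 1) + Poly_Mapping.lookup (rho S) j" if "1 \<le> j" for j
      unfolding beta tail rho sum.distrib[symmetric]
      by (rule sum.cong) (use Psi S that in \<open>fastforce split: if_splits\<close>)+
    \<comment> \<open>The intervals \<open>{a..<b}\<close> lie within \<open>{1..r}\<close>, so the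
      boundary values of \<open>M\<close> stay unshifted and agree with those supplied by
      \<open>pad\<close>.\<close>
    have zero: "Poly_Mapping.lookup (?beta S) j = 0" if "j = 0 \<or> j = r + 1" for j
      unfolding beta by (rule sum.neutral) (use Psi S that in fastforce)
    have pad: "pad r (d * L) N j = N j" if "j \<le> r + 1" for j
    proof -
      have "j = 0 \<or> j = r + 1 \<or> 1 \<le> j \<and> j \<le> r" using that by linarith
      then show ?thesis using zero[of j] M0 Mr by (auto simp: pad_def N_def)
    qed
    have p: "p j + int (Poly_Mapping.lookup (?tail S) j) =
        int (Poly_Mapping.lookup lam j) + int (Poly_Mapping.lookup (rho S) j)" if "j \<in> {1..r+1}" for j
    proof -
      have "p j = N (j - 1) - N j" using that pad[of j] pad[of "j - 1"] by (auto simp: p_def)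
      moreover have "int (Poly_Mapping.lookup (?beta S) j) + int (Poly_Mapping.lookup (?tail S) j) =
          int (Poly_Mapping.lookup (?beta S) (j - 1)) + int (Poly_Mapping.lookup (rho S) j)"
        using that step[of j] unfolding of_nat_add[symmetric] by auto
      ultimately show ?thesis using lamM[OF that] unfolding N_def by linarith
    qed
    have out: "Poly_Mapping.lookup lam j = 0" "Poly_Mapping.lookup (rho S) j = 0"
      "Poly_Mapping.lookup (?tail S) j = 0" if "j \<notin> {1..r+1}" for j
    proof -
      show "Poly_Mapping.lookup lam j = 0" using lam that by (metis in_keys_iff subsetD)
      show "Poly_Mapping.lookup (rho S) j = 0"
        unfolding rho by (rule sum.neutral) (use Psi S that in fastforce)
      show "Poly_Mapping.lookup (?tail S) j = 0"
        unfolding tail by (rule sum.neutral) (use Psi S that in fastforce)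
    qed
    have rho_split: "rho Psi = rho S + rho (Psi - S)"
      unfolding rho_def using sum.subset_diff[OF S fin] by (simp add: add.commute)
    have cN: "coeff_c r d L N = (if \<forall>j\<in>{1..r+1}. 0 \<le> p j
      then Poly_Mapping.lookup ?C (\<Sum>j=1..r+1. Poly_Mapping.single j (nat (p j))) else 0)"
      unfolding coeff_c_def p_def by (simp only: diff_ge_0_iff_ge)
    show ?thesis
    proof (cases "\<forall>j\<in>{1..r+1}. 0 \<le> p j")
      case True
      define n where "n = (\<Sum>j=1..r+1. Poly_Mapping.single j (nat (p j)))"
      have n: "Poly_Mapping.lookup n j = (if j \<in> {1..r+1} then nat (p j) else 0)" for j
        unfolding n_def lookup_sum lookup_single when_def by (rule sum.delta) simp
      have *: "lam + rho S = ?tail S + n"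
      proof (rule poly_mapping_eqI)
        fix j
        show "Poly_Mapping.lookup (lam + rho S) j = Poly_Mapping.lookup (?tail S + n) j"
        proof (cases "j \<in> {1..r+1}")
          case j: True
          then have "0 \<le> p j" using True by simp
          then show ?thesis using p[OF j] unfolding lookup_add n if_P[OF j] by linarith
        next
          case False
          then show ?thesis using out[OF False] unfolding lookup_add n if_not_P[OF False] by linarith
        qed
      qed
      have "lam + rho Psi = (lam + rho S) + rho (Psi - S)" by (simp only: rho_split add.assoc)
      also have "\<dots> = ?m + n" unfolding * by (simp only: add_ac)
      finally have "lam + rho Psi = ?m + n" .
      moreover have "coeff_c r d L N = Poly_Mapping.lookup ?C n" using cN True by (simp only: n_def) simp
      ultimately show ?thesis unfolding N_def by (simp only: lookup_single_mult)
    next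
      \<comment> \<open>With a negative exponent the left side is \<open>0\<close> by the convention
        in \<open>coeff_c\<close>. The right side is \<open>0\<close> because \<open>?m\<close>
        cannot be completed to \<open>lam + rho Psi\<close> by any monomial.\<close>
      case False
      have "lam + rho Psi \<noteq> ?m + n" for n
      proof
        assume "lam + rho Psi = ?m + n"
        then have "(lam + rho S) + rho (Psi - S) = (?tail S + n) + rho (Psi - S)"
          by (simp only: rho_split add_ac)
        then have *: "lam + rho S = ?tail S + n" by simp
        obtain j where j: "j \<in> {1..r+1}" "p j < 0" using False by auto
        show False using arg_cong[OF *, of "\<lambda>m. Poly_Mapping.lookup m j"] p[OF j(1)] j(2)
          unfolding lookup_add by linarith
      qed
      then have "Poly_Mapping.lookup (Poly_Mapping.single ?m ((- 1) ^ card S) * ?C) (lam + rho Psi) = 0"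
        by (rule lookup_single_mult_eq_0)
      moreover have "coeff_c r d L N = 0" unfolding cN by (rule if_not_P[OF False])
      ultimately show ?thesis unfolding N_def by (simp only: mult_zero_right)
    qed
  qed
  then show ?thesis
    unfolding weyl_denominator_expand[OF fin] vandermonde_expand[OF fin] shift_op_sum shift_op_single
      sum_distrib_right lookup_sum
    by (intro sum.cong) auto
qed

section \<open>Weyl's character formula for the blocks\<close>

definition pairs :: "nat set \<Rightarrow> (nat \<times> nat) set" where
  "pairs J = {(a, b). a \<in> J \<and> b \<in> J \<and> a < b}"

definition block_alternant :: "nat set \<Rightarrow> (nat \<Rightarrow> nat) \<Rightarrow> mpoly" where
  "block_alternant J v = alternant (card J) (\<lambda>j. v (enumerate J j)) (\<lambda>j. var (enumerate J j))"

lemma finite_pairs: "finite J \<Longrightarrow> finite (pairs J)"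
  by (rule finite_subset[of _ "J \<times> J"]) (auto simp: pairs_def)

lemma enumerate_image: "finite J \<Longrightarrow> enumerate J ` {..<card J} = J"
  using finite_bij_enumerate by (auto simp: bij_betw_def)

lemma enumerate_eq_iff:
  "finite J \<Longrightarrow> i < card J \<Longrightarrow> j < card J \<Longrightarrow> enumerate J i = enumerate J j \<longleftrightarrow> i = j"
  using finite_bij_enumerate[of J] by (auto simp: bij_betw_def inj_on_def)

lemma enumerate_obtain:
  assumes "finite J" "a \<in> J"
  obtains j where "j < card J" "a = enumerate J j"
  using assms enumerate_image[of J] by blast

text \<open>Expresses the staircase of the bialternant formula without reference to positions; this
  is the form that \<open>rho\<close> takes on a block.\<close>

lemma card_greater_enumerate:
  assumes J: "finite J" and j: "j < card J"
  shows "card {b \<in> J. enumerate J j < b} = card J - 1 - j"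
proof -
  have "{b \<in> J. enumerate J j < b} = enumerate J ` {j<..<card J}"
    using J j by (auto simp: finite_enumerate_in_set finite_enumerate_mono elim!: enumerate_obtain[OF J])
  moreover have "inj_on (enumerate J) {j<..<card J}"
    by (rule inj_onI) (simp add: enumerate_eq_iff[OF J])
  ultimately show ?thesis by (simp add: card_image)
qed

lemma vandermonde_pairs:
  assumes J: "finite J"
  shows "vandermonde (pairs J) =
    (\<Prod>j<card J. \<Prod>i<j. var (enumerate J i) - var (enumerate J j))"
proof -
  let ?e = "enumerate J"
  have "bij_betw (\<lambda>(j, i). (?e i, ?e j)) (SIGMA j:{..<card J}. {..<j}) (pairs J)"
    unfolding bij_betw_def
  proof
    show "inj_on (\<lambda>(j, i). (?e i, ?e j)) (SIGMA j:{..<card J}. {..<j})"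
      by (rule inj_onI) (auto simp: enumerate_eq_iff[OF J])
    show "(\<lambda>(j, i). (?e i, ?e j)) ` (SIGMA j:{..<card J}. {..<j}) = pairs J"
    proof
      show "(\<lambda>(j, i). (?e i, ?e j)) ` (SIGMA j:{..<card J}. {..<j}) \<subseteq> pairs J"
        using J by (auto simp: pairs_def finite_enumerate_in_set finite_enumerate_mono)
      show "pairs J \<subseteq> (\<lambda>(j, i). (?e i, ?e j)) ` (SIGMA j:{..<card J}. {..<j})"
      proof
        fix p assume "p \<in> pairs J"
        then obtain a b where p: "p = (a, b)" "a \<in> J" "b \<in> J" "a < b" by (auto simp: pairs_def)
        obtain i where i: "i < card J" "a = ?e i" by (rule enumerate_obtain[OF J p(2)])
        obtain j where j: "j < card J" "b = ?e j" by (rule enumerate_obtain[OF J p(3)])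
        have "i < j" using finite_enumerate_mono_iff[OF J i(1) j(1)] p(4) i j by simp
        then show "p \<in> (\<lambda>(j, i). (?e i, ?e j)) ` (SIGMA j:{..<card J}. {..<j})"
          using i j p(1) by (intro image_eqI[of _ _ "(j, i)"]) auto
      qed
    qed
  qed
  then have "vandermonde (pairs J) =
      (\<Prod>(j, i)\<in>(SIGMA j:{..<card J}. {..<j}). var (?e i) - var (?e j))"
    unfolding vandermonde_def by (subst prod.reindex_bij_betw[symmetric]) (auto simp: case_prod_beta)
  also have "\<dots> = (\<Prod>j<card J. \<Prod>i<j. var (?e i) - var (?e j))"
    by (rule prod.Sigma[symmetric]) auto
  finally show ?thesis .
qed

lemma vandermonde_mult_schur:
  assumes J: "finite J"
    and lam: "\<And>a b. a \<in> J \<Longrightarrow> b \<in> J \<Longrightarrow> a < b \<Longrightarrow> Poly_Mapping.lookup lam b \<le> Poly_Mapping.lookup lam a"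
  shows "vandermonde (pairs J) * schur J lam =
    block_alternant J (\<lambda>a. Poly_Mapping.lookup lam a + card {b \<in> J. a < b})"
proof -
  let ?e = "enumerate J" and ?f = "\<lambda>i. Poly_Mapping.lookup lam (enumerate J i)"
  have "strict_mono_on {..<card J} ?e"
    using J by (auto simp: strict_mono_on_def finite_enumerate_mono)
  then have "schur J lam = tableau_sum (card J) ?f (\<lambda>i. var (?e i))"
    using schur_eq_tableau_sum[of "card J" ?e lam] by (simp only: enumerate_image[OF J])
  moreover have "alternant (card J) (\<lambda>j. ?f j + (card J - 1 - j)) (\<lambda>i. var (?e i)) =
      (\<Prod>j<card J. \<Prod>i<j. var (?e i) - var (?e j)) * tableau_sum (card J) ?f (\<lambda>i. var (?e i))"
    by (rule alternant_eq_tableau_sum)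
       (use J in \<open>auto intro!: lam simp: finite_enumerate_in_set finite_enumerate_mono\<close>)
  moreover have "block_alternant J (\<lambda>a. Poly_Mapping.lookup lam a + card {b \<in> J. a < b}) =
      alternant (card J) (\<lambda>j. ?f j + (card J - 1 - j)) (\<lambda>i. var (?e i))"
    unfolding block_alternant_def by (rule alternant_cong) (simp_all add: card_greater_enumerate[OF J])
  ultimately show ?thesis by (simp only: vandermonde_pairs[OF J])
qed

lemma swap_vars_block_alternant:
  assumes J: "finite J" and ab: "a \<in> J" "b \<in> J" "a \<noteq> b"
  shows "swap_vars a b (block_alternant J v) = - block_alternant J v"
proof -
  let ?e = "enumerate J"
  obtain i where i: "i < card J" "a = ?e i" by (rule enumerate_obtain[OF J ab(1)])
  obtain j where j: "j < card J" "b = ?e j" by (rule enumerate_obtain[OF J ab(2)])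
  have "swap_vars a b (block_alternant J v) =
      alternant (card J) (\<lambda>j. v (?e j)) (\<lambda>l. var (?e (transpose i j l)))"
    unfolding block_alternant_def swap_vars_alternant swap_vars_var
    by (rule alternant_cong)
       (use i j enumerate_eq_iff[OF J] in \<open>auto simp: transpose_def\<close>)
  also have "\<dots> = - block_alternant J v"
    unfolding block_alternant_def
    by (rule alternant_transpose[of i "card J" j]) (use i j ab(3) in auto)
  finally show ?thesis .
qed

lemma swap_vars_block_alternant_outside:
  assumes J: "finite J" and ab: "a \<notin> J" "b \<notin> J"
  shows "swap_vars a b (block_alternant J v) = block_alternant J v"
  unfolding block_alternant_def swap_vars_alternant swap_vars_var
  by (rule alternant_cong)
     (use ab finite_enumerate_in_set[OF J] in \<open>auto simp: transpose_def\<close>)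

lemma var_power: "var i ^ n = Poly_Mapping.single (Poly_Mapping.single i n) 1"
  by (induction n) (auto simp: var_def mult_single single_add[symmetric])

lemma of_int_eq_single: "(of_int c :: mpoly) = Poly_Mapping.single 0 c"
  by (metis single_of_int of_int_eq_id id_apply)

lemma of_int_mult_single: "of_int c * Poly_Mapping.single m 1 = Poly_Mapping.single m c"
  for m :: monomial
  by (simp add: of_int_eq_single mult_single)

lemma block_alternant_expand:
  "block_alternant J v = (\<Sum>p | p permutes {0..<card J}. Poly_Mapping.single
    (\<Sum>j<card J. Poly_Mapping.single (enumerate J j) (v (enumerate J (p j)))) (sign p))"
proof -
  have "block_alternant J v = (\<Sum>p | p permutes {0..<card J}. of_int (sign p) *
      (\<Prod>i = 0..<card J. mat (card J) (card J) (\<lambda>(i, j). var (enumerate J i) ^ v (enumerate J j)) $$ (i, p i)))"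
    unfolding block_alternant_def alternant_def by (rule det_def') simp
  also have "\<dots> = (\<Sum>p | p permutes {0..<card J}. Poly_Mapping.single
    (\<Sum>j<card J. Poly_Mapping.single (enumerate J j) (v (enumerate J (p j)))) (sign p))"
  proof (rule sum.cong)
    fix p assume "p \<in> {p. p permutes {0..<card J}}"
    then have p: "p j < card J" if "j < card J" for j using permutes_in_image[of p "{0..<card J}"] that by auto
    have "(\<Prod>i = 0..<card J. mat (card J) (card J) (\<lambda>(i, j). var (enumerate J i) ^ v (enumerate J j)) $$ (i, p i)) =
        (\<Prod>i<card J. Poly_Mapping.single (Poly_Mapping.single (enumerate J i) (v (enumerate J (p i)))) 1)"
      by (rule prod.cong) (auto simp: p var_power)
    then show "of_int (sign p) *
      (\<Prod>i = 0..<card J. mat (card J) (card J) (\<lambda>(i, j). var (enumerate J i) ^ v (enumerate J j)) $$ (i, p i)) =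
      Poly_Mapping.single (\<Sum>j<card J. Poly_Mapping.single (enumerate J j) (v (enumerate J (p j)))) (sign p)"
      by (simp add: prod_single of_int_mult_single)
  qed simp
  finally show ?thesis .
qed

text \<open>A strictly increasing map of an initial segment never falls below the identity, and a
  permutation with that property is the identity. In \<open>lookup_weyl_sum\<close> this singles out
  the one strictly dominant term.\<close>

lemma permutes_mono_eq_id:
  assumes p: "p permutes {0..<n::nat}" and mono: "\<And>i j. i < j \<Longrightarrow> j < n \<Longrightarrow> p i < p j"
  shows "p = id"
proof (rule permutes_natset_ge[OF p], intro ballI)
  fix i assume "i \<in> {0..<n}"
  then have "i < n" by simp
  then show "i \<le> p i"
  proof (induction i)
    case (Suc i)
    then show ?case using mono[of i "Suc i"] by simp
  qed simp
qed

lemma positive_roots_eq: "positive_roots k I = (\<Union>i\<in>{1..k}. pairs (I i))"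
  by (simp add: positive_roots_def pairs_def)

section \<open>All blocks together: Weyl sums and strictly dominant monomials\<close>

locale block_system =
  fixes k :: nat and I :: "nat \<Rightarrow> nat set" and V :: "nat set"
  assumes finV: "finite V" and sub: "\<And>i. i \<in> {1..k} \<Longrightarrow> I i \<subseteq> V"
    and disj: "disjoint_family_on I {1..k}"
begin

text \<open>The numerator of Weyl's character formula, where \<open>v\<close> is a highest weight
  plus \<open>rho\<close>: a signed sum over the product of the symmetric groups of the blocks, with
  the indices outside the blocks left in place.\<close>

definition weyl_sum :: "monomial \<Rightarrow> mpoly" where
  "weyl_sum v = (\<Prod>m\<in>V - (\<Union>i\<in>{1..k}. I i). var m ^ Poly_Mapping.lookup v m) *
     (\<Prod>i=1..k. block_alternant (I i) (Poly_Mapping.lookup v))"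

definition strictly_dominant :: "monomial \<Rightarrow> bool" where
  "strictly_dominant v \<longleftrightarrow>
     (\<forall>a b. (a, b) \<in> positive_roots k I \<longrightarrow> Poly_Mapping.lookup v b < Poly_Mapping.lookup v a)"

lemma finite_block: "i \<in> {1..k} \<Longrightarrow> finite (I i)"
  using sub finV finite_subset by blast

lemma same_block: "i \<in> {1..k} \<Longrightarrow> j \<in> {1..k} \<Longrightarrow> a \<in> I i \<Longrightarrow> a \<in> I j \<Longrightarrow> i = j"
  using disj unfolding disjoint_family_on_def by blast

lemma positive_root_iff: "i \<in> {1..k} \<Longrightarrow> a \<in> I i \<Longrightarrow> (a, b) \<in> positive_roots k I \<longleftrightarrow> b \<in> I i \<and> a < b"
  using same_block[of i] unfolding positive_roots_def by blast

lemma finite_positive_roots: "finite (positive_roots k I)"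
  unfolding positive_roots_eq using finite_block finite_pairs by blast

lemma lookup_rho: "Poly_Mapping.lookup (rho (positive_roots k I)) a = card {b. (a, b) \<in> positive_roots k I}"
proof -
  have "Poly_Mapping.lookup (rho (positive_roots k I)) a = (\<Sum>p\<in>positive_roots k I. if fst p = a then 1 else 0)"
    by (simp add: rho_def lookup_sum case_prod_beta lookup_single when_def del: One_nat_def)
  also have "\<dots> = card {p \<in> positive_roots k I. fst p = a}"
    using finite_positive_roots by (simp add: sum.If_cases Int_def)
  also have "{p \<in> positive_roots k I. fst p = a} = Pair a ` {b. (a, b) \<in> positive_roots k I}"
    by auto
  also have "card \<dots> = card {b. (a, b) \<in> positive_roots k I}"
    by (rule card_image) (simp add: inj_on_def)
  finally show ?thesis .
qed

lemma lookup_rho_block: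
  assumes "i \<in> {1..k}" "a \<in> I i"
  shows "Poly_Mapping.lookup (rho (positive_roots k I)) a = card {b \<in> I i. a < b}"
  by (simp add: lookup_rho positive_root_iff[OF assms])

lemma lookup_rho_outside:
  assumes "a \<notin> (\<Union>i\<in>{1..k}. I i)"
  shows "Poly_Mapping.lookup (rho (positive_roots k I)) a = 0"
proof -
  have "{b. (a, b) \<in> positive_roots k I} = {}" using assms by (auto simp: positive_roots_def)
  then show ?thesis by (simp add: lookup_rho)
qed

lemma vandermonde_positive_roots:
  "vandermonde (positive_roots k I) = (\<Prod>i=1..k. vandermonde (pairs (I i)))"
  unfolding vandermonde_def positive_roots_eq
proof (rule prod.UNION_disjoint)
  show "\<forall>i\<in>{1..k}. finite (pairs (I i))" using finite_block finite_pairs by blast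
  show "\<forall>i\<in>{1..k}. \<forall>j\<in>{1..k}. i \<noteq> j \<longrightarrow> pairs (I i) \<inter> pairs (I j) = {}"
    using same_block by (auto simp: pairs_def)
qed simp

text \<open>The positive roots split by blocks, so the bialternant formula applies to each factor
  separately; outside the blocks \<open>rho\<close> vanishes and the one-dimensional factors are
  unchanged.\<close>

lemma vandermonde_mult_schurs:
  assumes "\<And>a b. (a, b) \<in> positive_roots k I \<Longrightarrow> Poly_Mapping.lookup lam b \<le> Poly_Mapping.lookup lam a"
  shows "vandermonde (positive_roots k I) *
      ((\<Prod>m\<in>V - (\<Union>i\<in>{1..k}. I i). var m ^ Poly_Mapping.lookup lam m) * (\<Prod>i=1..k. schur (I i) lam)) =
    weyl_sum (lam + rho (positive_roots k I))"
proof -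
  let ?v = "lam + rho (positive_roots k I)"
  have "(\<Prod>i=1..k. vandermonde (pairs (I i)) * schur (I i) lam) =
      (\<Prod>i=1..k. block_alternant (I i) (Poly_Mapping.lookup ?v))"
  proof (rule prod.cong)
    fix i assume i: "i \<in> {1..k}"
    have "vandermonde (pairs (I i)) * schur (I i) lam =
        block_alternant (I i) (\<lambda>a. Poly_Mapping.lookup lam a + card {b \<in> I i. a < b})"
      by (rule vandermonde_mult_schur[OF finite_block[OF i]], rule assms)
         (use i in \<open>auto simp: positive_roots_def\<close>)
    also have "\<dots> = block_alternant (I i) (Poly_Mapping.lookup ?v)"
      unfolding block_alternant_def
      by (rule alternant_cong)
         (simp_all add: lookup_add lookup_rho_block[OF i] finite_enumerate_in_set finite_block[OF i])
    finally show "vandermonde (pairs (I i)) * schur (I i) lam =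
        block_alternant (I i) (Poly_Mapping.lookup ?v)" .
  qed simp
  moreover have "(\<Prod>m\<in>V - (\<Union>i\<in>{1..k}. I i). var m ^ Poly_Mapping.lookup lam m) =
      (\<Prod>m\<in>V - (\<Union>i\<in>{1..k}. I i). var m ^ Poly_Mapping.lookup ?v m)"
    by (rule prod.cong) (simp_all add: lookup_add lookup_rho_outside)
  ultimately show ?thesis
    by (simp add: weyl_sum_def vandermonde_positive_roots prod.distrib mult_ac)
qed

text \<open>The two variables lie in one block, whose alternant changes sign. By disjointness no
  other factor contains either variable.\<close>

lemma swap_vars_weyl_sum:
  assumes "(a, b) \<in> positive_roots k I"
  shows "swap_vars a b (weyl_sum v) = - weyl_sum v"
proof -
  obtain i where i: "i \<in> {1..k}" "a \<in> I i" "b \<in> I i" "a < b"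
    using assms by (auto simp: positive_roots_def)
  let ?A = "\<lambda>i. block_alternant (I i) (Poly_Mapping.lookup v)"
  have "swap_vars a b (\<Prod>m\<in>V - (\<Union>i\<in>{1..k}. I i). var m ^ Poly_Mapping.lookup v m) =
      (\<Prod>m\<in>V - (\<Union>i\<in>{1..k}. I i). var m ^ Poly_Mapping.lookup v m)"
    unfolding swap_vars.hom_prod swap_vars.hom_power swap_vars_var
    by (rule prod.cong) (use i in \<open>auto simp: transpose_def\<close>)
  moreover have "swap_vars a b (\<Prod>i=1..k. ?A i) = - (\<Prod>i=1..k. ?A i)"
  proof -
    have "(\<Prod>j\<in>{1..k} - {i}. swap_vars a b (?A j)) = (\<Prod>j\<in>{1..k} - {i}. ?A j)"
      by (rule prod.cong, simp, rule swap_vars_block_alternant_outside)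
         (use i same_block finite_block in blast)+
    moreover have "(\<Prod>j=1..k. ?A j) = ?A i * (\<Prod>j\<in>{1..k} - {i}. ?A j)"
      using i(1) by (intro prod.remove) auto
    moreover have "swap_vars a b (?A i) = - ?A i"
      using swap_vars_block_alternant[OF finite_block[OF i(1)] i(2,3)] i(4) by simp
    ultimately show ?thesis by (simp only: swap_vars_mult swap_vars.hom_prod mult_minus_left)
  qed
  ultimately show ?thesis by (simp add: weyl_sum_def swap_vars.hom_mult)
qed

text \<open>Every term rearranges the exponents of \<open>v\<close> within the blocks. These are
  strictly decreasing on each block, so only the identity rearrangement leaves them so, and it has
  sign \<open>1\<close>.\<close>

lemma lookup_weyl_sum:
  assumes v: "strictly_dominant v" and m: "strictly_dominant m" and keys: "Poly_Mapping.keys v \<subseteq> V"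
  shows "Poly_Mapping.lookup (weyl_sum v) m = (if m = v then 1 else 0)"
proof -
  define e where "e i = enumerate (I i)" for i
  define n where "n i = card (I i)" for i
  define out where "out = (\<Sum>m\<in>V - (\<Union>i\<in>{1..k}. I i). Poly_Mapping.single m (Poly_Mapping.lookup v m))"
  define mon where "mon i p = (\<Sum>j<n i. Poly_Mapping.single (e i j) (Poly_Mapping.lookup v (e i (p j))))" for i p
  define F where "F = (\<Pi>\<^sub>E i\<in>{1..k}. {p. p permutes {0..<n i}})"
  \<comment> \<open>The monomial of the term that takes the permutation \<open>f i\<close> in block
    \<open>i\<close>.\<close>
  define T where "T f = out + (\<Sum>i=1..k. mon i (f i))" for f
  have "weyl_sum v = Poly_Mapping.single out 1 *
      (\<Prod>i=1..k. \<Sum>p | p permutes {0..<n i}. Poly_Mapping.single (mon i p) (sign p))"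
    by (simp add: weyl_sum_def var_power prod_single out_def block_alternant_expand mon_def n_def e_def)
  also have "(\<Prod>i=1..k. \<Sum>p | p permutes {0..<n i}. Poly_Mapping.single (mon i p) (sign p)) =
      (\<Sum>f\<in>F. \<Prod>i=1..k. Poly_Mapping.single (mon i (f i)) (sign (f i)))"
    unfolding F_def by (rule prod_sum_PiE) (auto simp: finite_permutations)
  finally have W: "weyl_sum v = (\<Sum>f\<in>F. Poly_Mapping.single (T f) (\<Prod>i=1..k. sign (f i)))"
    by (simp add: sum_distrib_left prod_single mult_single T_def)
  have e_in: "e i j \<in> I i" if "i \<in> {1..k}" "j < n i" for i j
    using finite_enumerate_in_set[OF finite_block[OF that(1)]] that(2) by (simp add: e_def n_def)
  have e_less: "e i j < e i j' \<longleftrightarrow> j < j'" if "i \<in> {1..k}" "j < n i" "j' < n i" for i j j'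
    using that finite_enumerate_mono_iff[OF finite_block[OF that(1)]] by (simp add: e_def n_def)
  have dom: "Poly_Mapping.lookup u (e i j') < Poly_Mapping.lookup u (e i j) \<longleftrightarrow> j < j'"
    if "strictly_dominant u" "i \<in> {1..k}" "j < n i" "j' < n i" for u i j j'
  proof -
    have *: "Poly_Mapping.lookup u (e i j') < Poly_Mapping.lookup u (e i j)" if "j < j'" "j' < n i" for j j'
      using that \<open>strictly_dominant u\<close> \<open>i \<in> {1..k}\<close> e_in[of i j] e_in[of i j'] e_less[of i j j']
      by (auto simp: strictly_dominant_def positive_root_iff)
    show ?thesis
      using *[of j j'] *[of j' j] that by (metis less_asym linorder_neqE_nat order_less_irrefl)
  qed
  have T_in: "Poly_Mapping.lookup (T f) (e i j) = Poly_Mapping.lookup v (e i (f i j))"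
    if i: "i \<in> {1..k}" and j: "j < n i" for f i j
  proof -
    have "Poly_Mapping.lookup out (e i j) = 0"
      unfolding out_def lookup_sum lookup_single
      by (rule sum.neutral) (use e_in[OF i j] i in \<open>auto simp: when_def\<close>)
    moreover have "(\<Sum>i'=1..k. Poly_Mapping.lookup (mon i' (f i')) (e i j)) =
        (\<Sum>i'=1..k. if i' = i then Poly_Mapping.lookup v (e i (f i j)) else 0)"
    proof (rule sum.cong)
      fix i' assume i': "i' \<in> {1..k}"
      have eq: "e i' j' = e i j \<longleftrightarrow> i' = i \<and> j' = j" if "j' < n i'" for j'
      proof
        assume *: "e i' j' = e i j"
        have ii: "i' = i" using same_block[OF i' i, of "e i j"] e_in[OF i j] e_in[OF i' that] * by simp
        then show "i' = i \<and> j' = j"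
          using * enumerate_eq_iff[OF finite_block[OF i], of j' j] that j by (simp add: e_def n_def)
      qed simp
      have "Poly_Mapping.lookup (mon i' (f i')) (e i j) =
          (\<Sum>j'<n i'. if j' = j then if i' = i then Poly_Mapping.lookup v (e i (f i j)) else 0 else 0)"
        unfolding mon_def lookup_sum lookup_single
        by (rule sum.cong) (use eq in \<open>auto simp: when_def\<close>)
      then show "Poly_Mapping.lookup (mon i' (f i')) (e i j) =
          (if i' = i then Poly_Mapping.lookup v (e i (f i j)) else 0)"
        using j by auto
    qed simp
    ultimately show ?thesis using i by (simp add: T_def lookup_add lookup_sum)
  qed
  have T_out: "Poly_Mapping.lookup (T f) a = Poly_Mapping.lookup v a" if a: "a \<notin> (\<Union>i\<in>{1..k}. I i)" for f a
  proof -
    have "Poly_Mapping.lookup (mon i (f i)) a = 0" if i: "i \<in> {1..k}" for i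
    proof -
      have "e i j \<noteq> a" if "j < n i" for j using e_in[OF i that] a i by blast
      then show ?thesis by (simp add: mon_def lookup_sum lookup_single when_def)
    qed
    moreover have "Poly_Mapping.lookup out a = Poly_Mapping.lookup v a"
    proof (cases "a \<in> V")
      case True
      then show ?thesis
        using a finV by (simp add: out_def lookup_sum lookup_single when_def)
    next
      case False
      then have "Poly_Mapping.lookup v a = 0" using keys by (metis in_keys_iff subsetD)
      moreover have "Poly_Mapping.lookup out a = 0"
        unfolding out_def lookup_sum lookup_single
        by (rule sum.neutral) (use False in \<open>auto simp: when_def\<close>)
      ultimately show ?thesis by simp
    qed
    ultimately show ?thesis by (simp add: T_def lookup_add lookup_sum)
  qed
  define f0 where "f0 = (\<lambda>i\<in>{1..k}. id :: nat \<Rightarrow> nat)"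
  have f0: "f0 \<in> F" by (auto simp: f0_def F_def permutes_id)
  have Tf0: "T f0 = v"
  proof (rule poly_mapping_eqI)
    fix a
    show "Poly_Mapping.lookup (T f0) a = Poly_Mapping.lookup v a"
    proof (cases "a \<in> (\<Union>i\<in>{1..k}. I i)")
      case True
      then obtain i where i: "i \<in> {1..k}" "a \<in> I i" by blast
      obtain j where "j < n i" "a = e i j"
        using enumerate_obtain[OF finite_block[OF i(1)] i(2)] unfolding n_def e_def by blast
      then show ?thesis using T_in[OF i(1), of j f0] i(1) by (simp add: f0_def)
    next
      case False
      then show ?thesis by (rule T_out)
    qed
  qed
  have uniq: "f = f0" if f: "f \<in> F" and T: "T f = m" for f
  proof
    fix i
    show "f i = f0 i"
    proof (cases "i \<in> {1..k}")
      case i: True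
      then have p: "f i permutes {0..<n i}" using f by (auto simp: F_def PiE_iff)
      have lt: "f i j < n i" if "j < n i" for j using permutes_in_image[OF p] that by auto
      \<comment> \<open>Along the block the exponents of \<open>m\<close> are those of
        \<open>v\<close> taken in the order given by \<open>f i\<close>. As both sequences decrease
        strictly, \<open>f i\<close> must be increasing.\<close>
      have "f i = id"
      proof (rule permutes_mono_eq_id[OF p])
        fix j j' assume jj': "j < j'" "j' < n i"
        then have "Poly_Mapping.lookup m (e i j') < Poly_Mapping.lookup m (e i j)"
          using dom[OF m i] by simp
        then have "Poly_Mapping.lookup v (e i (f i j')) < Poly_Mapping.lookup v (e i (f i j))"
          using T_in[OF i, of j f] T_in[OF i, of j' f] jj' T by simp
        then show "f i j < f i j'" using dom[OF v i] lt jj' by simp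
      qed
      then show ?thesis using i by (simp add: f0_def)
    next
      case False
      then show ?thesis using f by (auto simp: F_def f0_def PiE_iff extensional_def)
    qed
  qed
  have "finite F" by (auto simp: F_def finite_permutations intro!: finite_PiE)
  have "Poly_Mapping.lookup (weyl_sum v) m = (\<Sum>f\<in>F. if f = f0 then (if m = v then 1 else 0) else 0)"
    unfolding W lookup_sum lookup_single
  proof (rule sum.cong)
    fix f assume f: "f \<in> F"
    show "((\<Prod>i=1..k. sign (f i)) when T f = m) = (if f = f0 then (if m = v then 1 else 0) else 0)"
    proof (cases "f = f0")
      case True
      have "(\<Prod>i=1..k. sign (f0 i)) = 1" by (rule prod.neutral) (simp add: f0_def)
      then show ?thesis using True Tf0 by (auto simp: when_def)
    next
      case False
      then have "T f \<noteq> m" using uniq[OF f] by blast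
      then show ?thesis using False by simp
    qed
  qed simp
  then show ?thesis using f0 \<open>finite F\<close> by simp
qed

text \<open>On the elements \<open>c\<close> of the block with \<open>a < c\<close> and
  \<open>c \<le> b\<close>, the exponents are distinct and lie between that of \<open>b\<close>,
  included, and that of \<open>a\<close>, excluded. Their number, the drop of \<open>rho\<close>
  from \<open>a\<close> to \<open>b\<close>, is therefore at most the drop of \<open>v\<close>, so
  subtracting \<open>rho\<close> keeps the exponents weakly decreasing.\<close>

lemma strictly_dominant_card_le:
  assumes v: "strictly_dominant v" and ab: "(a, b) \<in> positive_roots k I"
  shows "card {c. (a, c) \<in> positive_roots k I} + Poly_Mapping.lookup v b \<le>
    card {c. (b, c) \<in> positive_roots k I} + Poly_Mapping.lookup v a"
proof -
  obtain i where i: "i \<in> {1..k}" "a \<in> I i" "b \<in> I i" "a < b"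
    using ab by (auto simp: positive_roots_def)
  have less: "Poly_Mapping.lookup v d < Poly_Mapping.lookup v c" if "c \<in> I i" "d \<in> I i" "c < d" for c d
    using v that i(1) by (auto simp: strictly_dominant_def positive_root_iff)
  let ?D = "{c \<in> I i. a < c \<and> c \<le> b}"
  have eq: "{c \<in> I i. a < c} = {c \<in> I i. b < c} \<union> ?D" using i by auto
  have "card {c \<in> I i. a < c} = card {c \<in> I i. b < c} + card ?D"
    unfolding eq using finite_block[OF i(1)] by (intro card_Un_disjoint) auto
  moreover have "card ?D \<le> card {Poly_Mapping.lookup v b..<Poly_Mapping.lookup v a}"
  proof (rule card_inj_on_le)
    show "inj_on (Poly_Mapping.lookup v) ?D"
      by (rule inj_onI) (metis (mono_tags, lifting) less linorder_neqE_nat mem_Collect_eq order_less_irrefl)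
    show "Poly_Mapping.lookup v ` ?D \<subseteq> {Poly_Mapping.lookup v b..<Poly_Mapping.lookup v a}"
    proof
      fix y assume "y \<in> Poly_Mapping.lookup v ` ?D"
      then obtain c where c: "y = Poly_Mapping.lookup v c" "c \<in> I i" "a < c" "c \<le> b" by auto
      have "Poly_Mapping.lookup v b \<le> y" using less[of c b] c i by (cases "c = b") auto
      then show "y \<in> {Poly_Mapping.lookup v b..<Poly_Mapping.lookup v a}" using less[of a c] c i by simp
    qed
  qed simp
  moreover have "Poly_Mapping.lookup v b < Poly_Mapping.lookup v a" using less i by simp
  ultimately show ?thesis
    using positive_root_iff[OF i(1,2)] positive_root_iff[OF i(1,3)] by simp
qed

text \<open>The later elements of the block of \<open>a\<close> have distinct exponents below that
  of \<open>a\<close>, so there are at most \<open>Poly_Mapping.lookup v a\<close> of them. Hence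
  \<open>v - rho (positive_roots k I)\<close> involves no truncation.\<close>

lemma strictly_dominant_rho_le:
  assumes v: "strictly_dominant v"
  shows "Poly_Mapping.lookup (rho (positive_roots k I)) a \<le> Poly_Mapping.lookup v a"
proof (cases "a \<in> (\<Union>i\<in>{1..k}. I i)")
  case True
  then obtain i where i: "i \<in> {1..k}" "a \<in> I i" by blast
  have less: "Poly_Mapping.lookup v d < Poly_Mapping.lookup v c" if "c \<in> I i" "d \<in> I i" "c < d" for c d
    using v that i(1) by (auto simp: strictly_dominant_def positive_root_iff)
  have "card {b \<in> I i. a < b} \<le> card {..<Poly_Mapping.lookup v a}"
  proof (rule card_inj_on_le)
    show "inj_on (Poly_Mapping.lookup v) {b \<in> I i. a < b}"
      by (rule inj_onI) (metis (mono_tags, lifting) less linorder_neqE_nat mem_Collect_eq order_less_irrefl)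
  qed (use less i in auto)
  then show ?thesis by (simp add: lookup_rho_block[OF i])
qed (simp add: lookup_rho_outside)

text \<open>Converse to \<open>strictly_dominant_add_rho\<close>: adding \<open>rho\<close> matches
  the dominant with the strictly dominant monomials.\<close>

lemma strictly_dominant_decompose:
  assumes v: "strictly_dominant v"
  obtains lam where "v = lam + rho (positive_roots k I)"
    "\<And>a b. (a, b) \<in> positive_roots k I \<Longrightarrow> Poly_Mapping.lookup lam b \<le> Poly_Mapping.lookup lam a"
proof
  let ?lam = "v - rho (positive_roots k I)"
  show *: "v = ?lam + rho (positive_roots k I)"
    by (rule poly_mapping_eqI) (simp add: lookup_add lookup_minus strictly_dominant_rho_le[OF v])
  fix a b assume ab: "(a, b) \<in> positive_roots k I"
  show "Poly_Mapping.lookup ?lam b \<le> Poly_Mapping.lookup ?lam a"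
    using strictly_dominant_card_le[OF v ab] strictly_dominant_rho_le[OF v, of a] strictly_dominant_rho_le[OF v, of b]
    unfolding lookup_minus lookup_rho by linarith
qed

lemma strictly_dominant_add_rho:
  assumes lam: "\<And>a b. (a, b) \<in> positive_roots k I \<Longrightarrow> Poly_Mapping.lookup lam b \<le> Poly_Mapping.lookup lam a"
  shows "strictly_dominant (lam + rho (positive_roots k I))"
  unfolding strictly_dominant_def
proof (intro allI impI)
  fix a b assume ab: "(a, b) \<in> positive_roots k I"
  then obtain i where i: "i \<in> {1..k}" "a \<in> I i" "b \<in> I i" "a < b"
    by (auto simp: positive_roots_def)
  have "card {c \<in> I i. b < c} < card {c \<in> I i. a < c}"
    by (rule psubset_card_mono) (use i finite_block in auto)
  then show "Poly_Mapping.lookup (lam + rho (positive_roots k I)) b <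
      Poly_Mapping.lookup (lam + rho (positive_roots k I)) a"
    using lam[OF ab] i by (simp add: lookup_add lookup_rho_block)
qed

end

lemma lookup_of_int_mult: "Poly_Mapping.lookup (of_int c * P) m = c * Poly_Mapping.lookup P m"
  for P :: mpoly
  using lookup_single_mult[of 0 c P m] by (simp add: of_int_eq_single)

text \<open>Integer polynomials have no zero divisors, so the Vandermonde factor can be cancelled to
  recover the expansion of the character.\<close>

lemma vandermonde_neq_0:
  assumes "finite Psi" "\<And>a b. (a, b) \<in> Psi \<Longrightarrow> a \<noteq> b"
  shows "vandermonde Psi \<noteq> 0"
proof -
  have "var a - var b \<noteq> 0" if "a \<noteq> b" for a b
  proof
    assume "var a - var b = 0"
    then have "Poly_Mapping.lookup (var a - var b) (Poly_Mapping.single a 1) = 0" by simp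
    then show False
      using that by (auto simp: var_def lookup_minus lookup_single when_def dest!: arg_cong[where f = "\<lambda>m. Poly_Mapping.lookup m a"] split: if_splits)
  qed
  then show ?thesis using assms by (auto simp: vandermonde_def)
qed

lemma homogeneous_vandermonde:
  assumes "finite V" "finite Psi" "\<And>a b. (a, b) \<in> Psi \<Longrightarrow> a \<in> V \<and> b \<in> V"
  shows "homogeneous V (card Psi) (vandermonde Psi)"
  unfolding vandermonde_def
proof (rule homogeneous_prod[OF assms(2)])
  fix p assume "p \<in> Psi"
  then show "homogeneous V 1 (case p of (a, b) \<Rightarrow> var a - var b)"
    using assms by (cases p) (auto intro!: homogeneous_diff homogeneous_var simp del: One_nat_def)
qed

section \<open>Multiplicities\<close>

theorem theorem1p4:
  fixes r L d k :: nat
    and I :: "nat \<Rightarrow> nat set"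
    and lam :: "nat \<Rightarrow>\<^sub>0 nat"
    and M :: "nat \<Rightarrow> int"
  assumes "r \<ge> 1" and "L \<ge> 1"
    and "\<And>i. i \<in> {1..k} \<Longrightarrow> I i \<subseteq> {1..r+1} \<and> card (I i) \<ge> 2"
    and "disjoint_family_on I {1..k}"
    and "lam \<in> highest_weights r d L k I"
    and "M 0 = int (d * L)" and "M (r + 1) = 0"
    and "\<And>j. j \<in> {1..r+1} \<Longrightarrow> int (Poly_Mapping.lookup lam j) = M (j - 1) - M j"
  shows "multiplicity_h r d L k I lam =
    shift_op (weyl_denominator (positive_roots k I)) (coeff_c r d L) M"
proof -
  define V where "V = {1..r+1}"
  define Psi where "Psi = positive_roots k I"
  define HW where "HW = highest_weights r d L k I"
  define C where "C = sym_char r d ^ L"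
  interpret block_system k I V
    by unfold_locales (use assms(3,4) in \<open>auto simp: V_def\<close>)
  have finPsi: "finite Psi" unfolding Psi_def by (rule finite_positive_roots)
  have Psi_V: "a \<in> V \<and> b \<in> V \<and> a < b" if "(a, b) \<in> Psi" for a b
    using that sub unfolding Psi_def positive_roots_def by blast
  have HW_iff: "mu \<in> HW \<longleftrightarrow> Poly_Mapping.keys mu \<subseteq> V \<and> (\<Sum>i\<in>V. Poly_Mapping.lookup mu i) = d * L \<and>
      (\<forall>a b. (a, b) \<in> Psi \<longrightarrow> Poly_Mapping.lookup mu b \<le> Poly_Mapping.lookup mu a)" for mu
    unfolding HW_def V_def highest_weights_def Psi_def positive_roots_def by blast
  have finHW: "finite HW"
    by (rule finite_subset[OF _ finite_monomials[OF finV, of "d * L"]]) (auto simp: HW_iff)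
  have dom: "strictly_dominant (mu + rho Psi)" if "mu \<in> HW" for mu
    using that unfolding Psi_def by (intro strictly_dominant_add_rho) (auto simp: HW_iff Psi_def)
  have keys_rho: "Poly_Mapping.keys (rho Psi) \<subseteq> V"
  proof
    fix a assume "a \<in> Poly_Mapping.keys (rho Psi)"
    then have "a \<in> (\<Union>i\<in>{1..k}. I i)" using lookup_rho_outside[of a] by (auto simp: Psi_def in_keys_iff)
    then show "a \<in> V" using sub by blast
  qed
  have irrep: "vandermonde Psi * irrep_char r k I mu = weyl_sum (mu + rho Psi)" if "mu \<in> HW" for mu
    using vandermonde_mult_schurs[of mu] that by (simp add: HW_iff irrep_char_def Psi_def V_def)
  have coeff_irrep: "Poly_Mapping.lookup (vandermonde Psi * irrep_char r k I mu) m =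
      (if m = mu + rho Psi then 1 else 0)" if "mu \<in> HW" "strictly_dominant m" for mu m
    unfolding irrep[OF that(1)]
  proof (rule lookup_weyl_sum[OF dom[OF that(1)] that(2)])
    show "Poly_Mapping.keys (mu + rho Psi) \<subseteq> V"
      using keys_add[of mu "rho Psi"] keys_rho that(1) by (auto simp: HW_iff)
  qed
  have coeff_sum: "Poly_Mapping.lookup (vandermonde Psi * (\<Sum>mu\<in>HW. of_int (c mu) * irrep_char r k I mu)) m =
      (\<Sum>mu\<in>HW. if m = mu + rho Psi then c mu else 0)" if "strictly_dominant m" for c m
  proof -
    have "vandermonde Psi * (\<Sum>mu\<in>HW. of_int (c mu) * irrep_char r k I mu) =
        (\<Sum>mu\<in>HW. of_int (c mu) * (vandermonde Psi * irrep_char r k I mu))"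
      by (simp add: sum_distrib_left mult_ac)
    then show ?thesis
      by (auto simp: lookup_sum lookup_of_int_mult coeff_irrep that intro!: sum.cong)
  qed
  \<comment> \<open>The coefficients of any expansion can be read off in this way, which yields
    their uniqueness and dictates the candidate \<open>mult\<close>.\<close>
  have coeff_sum_rho: "Poly_Mapping.lookup
      (vandermonde Psi * (\<Sum>mu\<in>HW. of_int (c mu) * irrep_char r k I mu)) (nu + rho Psi) = c nu"
    if "nu \<in> HW" for c nu
    using finHW that by (simp add: coeff_sum[OF dom[OF that]])
  define mult where "mult nu = (if nu \<in> HW then Poly_Mapping.lookup (vandermonde Psi * C) (nu + rho Psi) else 0)" for nu
  \<comment> \<open>The empty tableau is the only one of weight \<open>0\<close>, so the Vandermonde
    product is itself the Weyl sum at \<open>rho Psi\<close> and inherits its antisymmetry.\<close>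
  have swapV: "swap_vars a b (vandermonde Psi) = - vandermonde Psi" if "(a, b) \<in> Psi" for a b
  proof -
    have "schur (I i) 0 = 1" for i
    proof -
      have "ssyt (I i) 0 = {\<lambda>_. undefined}" by (auto simp: ssyt_def boxes_def)
      then show ?thesis by (simp add: schur_def boxes_def)
    qed
    then have "vandermonde Psi = weyl_sum (0 + rho Psi)"
      using vandermonde_mult_schurs[of 0] by (simp add: Psi_def)
    then show ?thesis using swap_vars_weyl_sum that by (simp add: Psi_def)
  qed
  have swapC: "swap_vars a b C = C" if "(a, b) \<in> Psi" for a b
    using swap_vars_complete_homogeneous[OF finV, of a b d] Psi_V[OF that]
    by (simp add: C_def sym_char_def swap_vars.hom_power V_def)
  \<comment> \<open>Each root contributes one unit to \<open>rho Psi\<close>, so removing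
    \<open>rho Psi\<close> from a monomial of degree \<open>card Psi + d * L\<close> leaves the
    degree \<open>d * L\<close> of a highest weight.\<close>
  have degree: "(\<Sum>i\<in>V. Poly_Mapping.lookup (rho Psi) i) = card Psi"
  proof -
    have "Psi = (SIGMA a:V. {b. (a, b) \<in> Psi})" using Psi_V by auto
    moreover have "finite {b. (a, b) \<in> Psi}" for a
      by (rule finite_subset[OF _ finV]) (use Psi_V in blast)
    ultimately have "card Psi = (\<Sum>a\<in>V. card {b. (a, b) \<in> Psi})"
      using card_SigmaI[OF finV, of "\<lambda>a. {b. (a, b) \<in> Psi}"] by simp
    then show ?thesis by (simp add: lookup_rho Psi_def)
  qed
  have homog: "homogeneous V (card Psi + d * L) (vandermonde Psi * C)"
    unfolding C_def sym_char_def V_def[symmetric]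
    by (intro homogeneous_mult homogeneous_vandermonde homogeneous_power
        homogeneous_complete_homogeneous finV finPsi) (use Psi_V in blast)
  define Q where "Q = vandermonde Psi * C - vandermonde Psi * (\<Sum>mu\<in>HW. of_int (mult mu) * irrep_char r k I mu)"
  have "Q = 0"
  proof (rule antisymmetric_eq_0I[where R = Psi])
    fix a b assume ab: "(a, b) \<in> Psi"
    show "a < b" using Psi_V[OF ab] by simp
    have "vandermonde Psi * (\<Sum>mu\<in>HW. of_int (mult mu) * irrep_char r k I mu) =
        (\<Sum>mu\<in>HW. of_int (mult mu) * weyl_sum (mu + rho Psi))"
      by (simp add: sum_distrib_left mult.left_commute[of "vandermonde Psi"] irrep cong: sum.cong)
    moreover have "swap_vars a b (\<Sum>mu\<in>HW. of_int (mult mu) * weyl_sum (mu + rho Psi)) =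
        - (\<Sum>mu\<in>HW. of_int (mult mu) * weyl_sum (mu + rho Psi))"
      using swap_vars_weyl_sum[of a b] ab
      by (simp add: swap_vars.hom_sum swap_vars_mult swap_vars.hom_of_int sum_negf Psi_def)
    ultimately show "swap_vars a b Q = - Q"
      unfolding Q_def by (simp add: swap_vars_diff swap_vars_mult swapV[OF ab] swapC[OF ab])
  next
    fix m :: monomial assume "\<And>a b. (a, b) \<in> Psi \<Longrightarrow> Poly_Mapping.lookup m b < Poly_Mapping.lookup m a"
    then have m: "strictly_dominant m" by (simp add: strictly_dominant_def Psi_def)
    obtain nu where nu: "m = nu + rho Psi"
      "\<And>a b. (a, b) \<in> Psi \<Longrightarrow> Poly_Mapping.lookup nu b \<le> Poly_Mapping.lookup nu a"
      using strictly_dominant_decompose[OF m] unfolding Psi_def by blast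
    show "Poly_Mapping.lookup Q m = 0"
    proof (cases "nu \<in> HW")
      case True
      then show ?thesis by (simp add: Q_def lookup_minus nu(1) coeff_sum_rho mult_def)
    next
      case False
      \<comment> \<open>As \<open>nu\<close> already decreases weakly on the blocks, it can only
        fail to be a highest weight through its support or its degree. Homogeneity then excludes
        \<open>m\<close> from the product.\<close>
      have "m \<notin> Poly_Mapping.keys (vandermonde Psi * C)"
      proof
        assume "m \<in> Poly_Mapping.keys (vandermonde Psi * C)"
        then have keys: "Poly_Mapping.keys m \<subseteq> V" and
          deg: "(\<Sum>i\<in>V. Poly_Mapping.lookup m i) = card Psi + d * L"
          using homog by (auto simp: homogeneous_def)
        have "Poly_Mapping.keys nu \<subseteq> Poly_Mapping.keys m" by (auto simp: nu(1) in_keys_iff lookup_add)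
        moreover have "(\<Sum>i\<in>V. Poly_Mapping.lookup nu i) = d * L"
          using deg degree by (simp add: nu(1) lookup_add sum.distrib)
        ultimately have "nu \<in> HW" using keys nu(2) by (auto simp: HW_iff)
        then show False using False by simp
      qed
      moreover have "(\<Sum>mu\<in>HW. if m = mu + rho Psi then mult mu else 0) = 0"
        by (rule sum.neutral) (use False nu(1) in auto)
      ultimately show ?thesis by (simp add: Q_def lookup_minus coeff_sum[OF m] in_keys_iff)
    qed
  qed
  moreover have "vandermonde Psi \<noteq> 0"
    by (rule vandermonde_neq_0[OF finPsi]) (use Psi_V in fastforce)
  ultimately have expand: "C = (\<Sum>mu\<in>HW. of_int (mult mu) * irrep_char r k I mu)"
    by (simp add: Q_def)
  have "multiplicity_h r d L k I = mult"
    unfolding multiplicity_h_def HW_def[symmetric] C_def[symmetric]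
  \<comment> \<open>Existence is \<open>expand\<close>. For uniqueness, \<open>coeff_sum_rho\<close>
    determines each value on \<open>HW\<close>, and elsewhere the values are fixed to
    \<open>0\<close>.\<close>
  proof (rule the_equality)
    show "(\<forall>lam. lam \<notin> HW \<longrightarrow> mult lam = 0) \<and> C = (\<Sum>lam\<in>HW. of_int (mult lam) * irrep_char r k I lam)"
      using expand by (simp add: mult_def)
  next
    fix c assume c: "(\<forall>lam. lam \<notin> HW \<longrightarrow> c lam = 0) \<and> C = (\<Sum>lam\<in>HW. of_int (c lam) * irrep_char r k I lam)"
    show "c = mult"
    proof
      fix nu
      show "c nu = mult nu"
      proof (cases "nu \<in> HW")
        case True
        have "mult nu = Poly_Mapping.lookup (vandermonde Psi * C) (nu + rho Psi)"
          using True by (simp add: mult_def)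
        also have "\<dots> = c nu" using c coeff_sum_rho[OF True, of c] by simp
        finally show ?thesis ..
      qed (use c in \<open>simp add: mult_def\<close>)
    qed
  qed
  moreover have "shift_op (weyl_denominator Psi) (coeff_c r d L) M =
      Poly_Mapping.lookup (vandermonde Psi * sym_char r d ^ L) (lam + rho Psi)"
    by (rule shift_weyl_denominator[OF finPsi _ _ assms(6-8)])
       (use Psi_V assms(5) in \<open>auto simp: V_def HW_iff[unfolded HW_def V_def]\<close>)
  ultimately show ?thesis using assms(5) by (simp add: mult_def HW_def C_def Psi_def)
qed

end
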